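(* Let $p>3$ be a prime and put $\Phi=p-2$. Then the number of conjugacy classes (under conjugation in $\mathrm{PGL}_{3}(\mathbb{C})$) of admissible cyclic subgroups of order $p$ of $\mathrm{PGL}_{3}(\mathbb{C})$ is \begin{itemize} \item $1+\dfrac{\Phi-3}{6}$ if $p\not\equiv 1 \pmod 3$; \item $2+\dfrac{\Phi-5}{6}$ if $p\equiv 1 \pmod 3$. \end{itemize}
   Context: A set of points in $\mathbb{P}^k(\mathbb{C})$ is in general position if any subset of $t\le k+1$ of its points spans a $(t-1)$-dimensional linear projective subspace. The group $\mathrm{PGL}_{k+1}(\mathbb{C})$ acts on $\mathbb{P}^k(\mathbb{C})$ and hence on finite sets of points; for a finite set $T$ of points, $\mathrm{Aut}(T)=\{f\in \mathrm{PGL}_{k+1}(\mathbb{C}) : T^f=T\}$ (setwise stabilizer). A finite subgroup $H$ of $\mathrm{PGL}_{k+1}(\mathbb{C})$ is called admissible if there exists a finite set $T$ of $n\ge k+3$ distinct points of $\mathbb{P}^k(\mathbb{C})$ in general position such that $H\subseteq \mathrm{Aut}(T)$. Here $k=2$. *)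

theory Defs
  imports
    "HOL-Analysis.Analysis"
    "HOL-Algebra.Group_Action"
    "HOL-Algebra.Elementary_Groups"
    "HOL-Number_Theory.Cong"
begin

text \<open>The index type \<open>'n\<close> has \<open>k + 1\<close> elements, so that \<open>complex^'n\<close> is the vector space
  whose lines are the points of the complex projective space of dimension \<open>k\<close>.  Linear notions over
  the complex numbers carry the prefix \<open>vec\<close>; the unprefixed ones are over the reals.\<close>

definition proj_space :: "(complex^'n) set set" where
  "proj_space = {L. vec.subspace L \<and> vec.dim L = 1}"

definition GL :: "(complex^'n^'n) monoid" where
  "GL = \<lparr>carrier = {A. invertible A}, mult = (**), one = mat 1\<rparr>"

definition scalars :: "(complex^'n^'n) set" where
  "scalars = {mat c |c. c \<noteq> 0}"

definition PGL :: "(complex^'n^'n) set monoid" where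
  "PGL = GL Mod scalars"

definition proj_act :: "(complex^'n^'n) set \<Rightarrow> (complex^'n) set \<Rightarrow> (complex^'n) set" where
  "proj_act f L = {A *v v |A v. A \<in> f \<and> v \<in> L}"

text \<open>A projective linear subspace of dimension \<open>t - 1\<close> is a linear subspace of
  dimension \<open>t\<close>.\<close>

definition general_position :: "(complex^'n) set set \<Rightarrow> bool" where
  "general_position T \<longleftrightarrow>
     T \<subseteq> proj_space \<and>
     (\<forall>S\<subseteq>T. finite S \<and> card S \<le> CARD('n) \<longrightarrow> vec.dim (vec.span (\<Union>S)) = card S)"

definition Aut :: "(complex^'n) set set \<Rightarrow> (complex^'n^'n) set set" where
  "Aut T = {f \<in> carrier PGL. proj_act f ` T = T}"

text \<open>The bound \<open>k + 3\<close> on the number of points is \<open>CARD('n) + 2\<close>.\<close>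

definition admissible :: "(complex^'n^'n) set set \<Rightarrow> bool" where
  "admissible H \<longleftrightarrow>
     subgroup H PGL \<and> finite H \<and>
     (\<exists>T. finite T \<and> card T \<ge> CARD('n) + 2 \<and> general_position T \<and> H \<subseteq> Aut T)"

definition conjugate :: "('a, 'b) monoid_scheme \<Rightarrow> 'a \<Rightarrow> 'a set \<Rightarrow> 'a set" where
  "conjugate G g H = g <#\<^bsub>G\<^esub> H #>\<^bsub>G\<^esub> inv\<^bsub>G\<^esub> g"

text \<open>The following facts confirm that the constructions above are well defined.\<close>

lemma group_GL: "group (GL :: (complex^'n^'n) monoid)"
proof (rule groupI)
  fix A :: "complex^'n^'n" assume "A \<in> carrier GL"
  then obtain B where "A ** B = mat 1" "B ** A = mat 1"
    unfolding GL_def invertible_def by auto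
  then have "B \<in> carrier GL" "B \<otimes>\<^bsub>GL\<^esub> A = \<one>\<^bsub>GL\<^esub>"
    unfolding GL_def invertible_def by auto
  then show "\<exists>B\<in>carrier GL. B \<otimes>\<^bsub>GL\<^esub> A = \<one>\<^bsub>GL\<^esub>" by blast
next
  show "\<one>\<^bsub>GL\<^esub> \<in> carrier (GL :: (complex^'n^'n) monoid)"
    unfolding GL_def invertible_def by (auto intro: exI[of _ "mat 1"])
qed (simp_all add: GL_def invertible_mult matrix_mul_assoc)

lemma mat_mult_left: "mat c ** A = (\<chi> i j. c * A $ i $ j)" for A :: "complex^'n^'n"
  unfolding matrix_matrix_mult_def mat_def
  by (simp add: vec_eq_iff if_distrib if_distribR sum.delta'[OF finite] cong: if_cong)

lemma mat_mult_right: "A ** mat c = (\<chi> i j. A $ i $ j * c)" for A :: "complex^'n^'n"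
  unfolding matrix_matrix_mult_def mat_def
  by (simp add: vec_eq_iff if_distrib if_distribR sum.delta'[OF finite] cong: if_cong)

lemma mat_commute: "A ** mat c = mat c ** A" for A :: "complex^'n^'n"
  by (simp add: mat_mult_left mat_mult_right mult.commute)

lemma mat_mult_mat: "mat c ** mat d = (mat (c * d) :: complex^'n^'n)"
  by (simp add: mat_mult_left) (simp add: mat_def vec_eq_iff)

lemma mat_mult_vec: "mat c *v v = c *s v" for v :: "complex^'n"
  unfolding matrix_vector_mult_def mat_def
  by (simp add: vec_eq_iff if_distrib if_distribR sum.delta'[OF finite] cong: if_cong)

lemma scalars_normal: "scalars \<lhd> (GL :: (complex^'n^'n) monoid)"
proof -
  interpret group "GL :: (complex^'n^'n) monoid" by (rule group_GL)
  have sub: "mat c \<in> carrier (GL :: (complex^'n^'n) monoid)"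
    and inv: "inv\<^bsub>GL\<^esub> (mat c :: complex^'n^'n) = mat (inverse c)" if "c \<noteq> 0" for c
  proof -
    have inverses: "mat c ** mat (inverse c) = (mat 1 :: complex^'n^'n)"
      "mat (inverse c) ** mat c = (mat 1 :: complex^'n^'n)"
      using that by (simp_all add: mat_mult_mat)
    then have carr: "mat c \<in> carrier (GL :: (complex^'n^'n) monoid)"
      "mat (inverse c) \<in> carrier (GL :: (complex^'n^'n) monoid)"
      unfolding GL_def invertible_def by auto
    show "mat c \<in> carrier (GL :: (complex^'n^'n) monoid)" by (rule carr)
    show "inv\<^bsub>GL\<^esub> (mat c :: complex^'n^'n) = mat (inverse c)"
      by (rule inv_equality[OF _ carr]) (simp add: GL_def inverses)
  qed
  have "subgroup scalars (GL :: (complex^'n^'n) monoid)"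
  proof (rule subgroupI)
    show "scalars \<subseteq> carrier (GL :: (complex^'n^'n) monoid)"
      unfolding scalars_def using sub by blast
    have "mat 1 \<in> (scalars :: (complex^'n^'n) set)"
      unfolding scalars_def using one_neq_zero by blast
    then show "scalars \<noteq> ({} :: (complex^'n^'n) set)" by blast
  next
    fix A :: "complex^'n^'n" assume "A \<in> scalars"
    then obtain c where c: "c \<noteq> 0" "A = mat c" unfolding scalars_def by blast
    then have "inv\<^bsub>GL\<^esub> A = mat (inverse c)" "inverse c \<noteq> 0" using inv by simp_all
    then show "inv\<^bsub>GL\<^esub> A \<in> scalars" unfolding scalars_def by blast
  next
    fix A B :: "complex^'n^'n" assume "A \<in> scalars" "B \<in> scalars"
    then obtain c d where c: "c \<noteq> 0" "A = mat c" and d: "d \<noteq> 0" "B = mat d"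
      unfolding scalars_def by blast
    have "A \<otimes>\<^bsub>GL\<^esub> B = mat (c * d)" "c * d \<noteq> 0" using c d by (simp_all add: GL_def mat_mult_mat)
    then show "A \<otimes>\<^bsub>GL\<^esub> B \<in> scalars" unfolding scalars_def by blast
  qed
  moreover have "scalars #>\<^bsub>GL\<^esub> A = A <#\<^bsub>GL\<^esub> scalars" for A :: "complex^'n^'n"
  proof -
    have "B \<otimes>\<^bsub>GL\<^esub> A = A \<otimes>\<^bsub>GL\<^esub> B" if "B \<in> scalars" for B :: "complex^'n^'n"
      using that unfolding scalars_def by (auto simp: GL_def mat_commute)
    then show ?thesis unfolding r_coset_def l_coset_def by simp
  qed
  ultimately show ?thesis by (intro normalI) simp_all
qed

lemma group_PGL: "group (PGL :: (complex^'n^'n) set monoid)"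
  unfolding PGL_def by (rule normal.factorgroup_is_group[OF scalars_normal])

lemma proj_act_coset:
  assumes "L \<in> proj_space"
  shows "proj_act (scalars #>\<^bsub>GL\<^esub> A) L = (*v) A ` L"
proof -
  have sub: "vec.subspace L" using assms by (simp add: proj_space_def)
  have eq: "(mat c ** A) *v v = A *v (c *s v)" for c v
    by (simp add: matrix_vector_mul_assoc[symmetric] mat_mult_vec vec.scale)
  have "proj_act (scalars #>\<^bsub>GL\<^esub> A) L = {A *v (c *s v) |c v. c \<noteq> 0 \<and> v \<in> L}"
    unfolding proj_act_def r_coset_def scalars_def eq[symmetric] by (auto simp: GL_def)
  also have "\<dots> = (*v) A ` L"
  proof (intro equalityI subsetI)
    fix w assume "w \<in> {A *v (c *s v) |c v. c \<noteq> 0 \<and> v \<in> L}"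
    then show "w \<in> (*v) A ` L" using vec.subspace_scale[OF sub] by blast
  next
    fix w assume "w \<in> (*v) A ` L"
    then obtain v where "v \<in> L" "w = A *v (1 *s v)" by auto
    then show "w \<in> {A *v (c *s v) |c v. c \<noteq> 0 \<and> v \<in> L}" using one_neq_zero by blast
  qed
  finally show ?thesis .
qed

end

theory Submission
  imports Defs "HOL-Algebra.FiniteProduct"
begin

text \<open>Let \<open>H\<close> be admissible and cyclic of order \<open>p\<close>. A generator has a representative \<open>A\<close> with \<open>A\<^sup>p = 1\<close>, so
  \<open>A\<close> is diagonalisable and its eigenvalues are \<open>p\<close>-th roots of unity. If two of them agreed, \<open>A\<close>
  would differ from a scalar by a matrix of rank one, every orbit would lie on a line, and no
  invariant set of five points could be in general position
  (\<open>scalar_if_rank_one_deviation\<close>). So the eigenvalues are powers of a primitive root \<open>\<zeta>\<close> with three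
  distinct exponents modulo \<open>p\<close>. Replacing \<open>A\<close> by a scalar multiple translates the exponents,
  and replacing it by another generator multiplies them by a unit, so \<open>H\<close> is conjugate to the
  group generated by \<open>diag(1, \<zeta>, \<zeta>\<^sup>b)\<close> for some residue \<open>b\<close> other than \<open>0\<close> and \<open>1\<close>
  (\<open>admissible_imp_std_class\<close>).

  Conversely each of these groups is admissible, by way of the orbit of \<open>[1 : 1 : 1]\<close>. Three of its
  points are never collinear: a collinearity reads \<open>(u - 1) / (v - 1) = (u\<^sup>b - 1) / (v\<^sup>b - 1)\<close> for two
  distinct \<open>p\<close>-th roots of unity \<open>u, v \<noteq> 1\<close>, and dividing this equation by its complex conjugate yields
  \<open>u / v = (u / v)\<^sup>b\<close>, which is impossible (\<open>det_orbit_vec\<close>, \<open>std_subgroup_admissible\<close>).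

  Two of these groups are conjugate iff their exponent sets \<open>{0, 1, b}\<close> and \<open>{0, 1, c}\<close> are related by an
  affine map of the integers modulo \<open>p\<close>, which means that \<open>b\<close> and \<open>c\<close> lie in the same orbit of the
  anharmonic group generated by \<open>b \<mapsto> 1 - b\<close> and \<open>b \<mapsto> 1 / b\<close>
  (\<open>anharmonic_imp_std_class_eq\<close>, \<open>std_class_eq_imp_anharmonic\<close>). On the \<open>p - 2\<close> residues other than \<open>0\<close> and \<open>1\<close>
  this group of order six has the orbit \<open>{-1, 2, 1/2}\<close>, possibly the orbit of the two roots of
  \<open>X\<^sup>2 - X + 1\<close>, and otherwise regular orbits. Hence \<open>p - 2 = 3 + 2 e + 6 m\<close> with \<open>e\<close> at most \<open>1\<close>, and the
  number of orbits is \<open>1 + e + m\<close> (\<open>card_anharmonic_classes\<close>). Reducing this equation modulo \<open>3\<close>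
  determines \<open>e\<close>, which gives the two cases.\<close>

section \<open>Representatives of projectivities and conjugacy of subgroups\<close>

definition proj_class :: "complex^'n^'n \<Rightarrow> (complex^'n^'n) set" where
  "proj_class A = scalars #>\<^bsub>GL\<^esub> A"

text \<open>Two matrices represent the same projectivity exactly when they differ by a nonzero scalar; the
  next facts turn computations in the quotient group into computations with such representatives.\<close>
lemma mem_proj_class: "B \<in> proj_class A \<longleftrightarrow> (\<exists>c. c \<noteq> 0 \<and> B = mat c ** A)"
  unfolding proj_class_def r_coset_def scalars_def by (auto simp: GL_def)

lemma proj_class_eq_iff: "proj_class A = proj_class B \<longleftrightarrow> (\<exists>c. c \<noteq> 0 \<and> A = mat c ** B)"
proof
  assume "proj_class A = proj_class B"
  moreover have "A \<in> proj_class A"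
    unfolding mem_proj_class by (intro exI[of _ 1]) simp
  ultimately show "\<exists>c. c \<noteq> 0 \<and> A = mat c ** B" by (simp add: mem_proj_class)
next
  assume "\<exists>c. c \<noteq> 0 \<and> A = mat c ** B"
  then obtain c where c: "c \<noteq> 0" "A = mat c ** B" by blast
  have "\<exists>d. d \<noteq> 0 \<and> mat e ** A = mat d ** B" if "e \<noteq> 0" for e
    using that c by (intro exI[of _ "e * c"]) (simp add: matrix_mul_assoc mat_mult_mat)
  moreover have "\<exists>d. d \<noteq> 0 \<and> mat e ** B = mat d ** A" if "e \<noteq> 0" for e
    using that c by (intro exI[of _ "e / c"]) (simp add: matrix_mul_assoc mat_mult_mat)
  ultimately show "proj_class A = proj_class B" by (auto simp: mem_proj_class)
qed

lemma carrier_GL [simp]: "A \<in> carrier GL \<longleftrightarrow> invertible A"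
  and mult_GL [simp]: "A \<otimes>\<^bsub>GL\<^esub> B = A ** B"
  and one_GL [simp]: "\<one>\<^bsub>GL\<^esub> = mat 1"
  by (simp_all add: GL_def)

lemma carrier_PGL: "carrier PGL = proj_class ` {A. invertible A}"
  unfolding PGL_def FactGroup_def RCOSETS_def proj_class_def by auto

lemma hom_proj_class: "proj_class \<in> hom GL PGL"
  unfolding PGL_def proj_class_def [abs_def] by (rule normal.r_coset_hom_Mod[OF scalars_normal])

lemma proj_class_mult:
  assumes "invertible A" "invertible B"
  shows "proj_class A \<otimes>\<^bsub>PGL\<^esub> proj_class B = proj_class (A ** B)"
  using hom_mult[OF hom_proj_class, of A B] assms by simp

lemma one_PGL: "\<one>\<^bsub>PGL\<^esub> = proj_class (mat 1)"
  using hom_one[OF hom_proj_class group_GL group_PGL, symmetric] by (simp only: one_GL)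

lemma proj_class_pow:
  assumes "invertible A"
  shows "proj_class A [^]\<^bsub>PGL\<^esub> (n::nat) = proj_class (A [^]\<^bsub>GL\<^esub> n)"
  using hom_nat_pow[OF hom_proj_class _ group_GL group_PGL, of A n] assms by simp

lemma (in group) conjugate_eq_image: "conjugate G g H = (\<lambda>h. g \<otimes> h \<otimes> inv g) ` H"
  unfolding conjugate_def l_coset_def r_coset_def by auto

lemma (in group) conjugate_conjugate:
  assumes "g \<in> carrier G" "h \<in> carrier G" "H \<subseteq> carrier G"
  shows "conjugate G g (conjugate G h H) = conjugate G (g \<otimes> h) H"
  unfolding conjugate_eq_image image_image using assms
  by (intro image_cong) (auto simp: inv_mult_group m_assoc subset_iff)

lemma (in group) conjugate_one:
  assumes "H \<subseteq> carrier G"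
  shows "conjugate G \<one> H = H"
  unfolding conjugate_eq_image using assms by (auto simp: subset_iff image_iff)

text \<open>Conjugation satisfies the laws of an action on subsets of the carrier, which makes equality of
  two orbits the same as conjugacy of the two subsets.\<close>
lemma (in group) orbit_conjugate_eq_iff:
  assumes H: "H \<subseteq> carrier G" and K: "K \<subseteq> carrier G"
  shows "orbit G (conjugate G) H = orbit G (conjugate G) K \<longleftrightarrow> (\<exists>g\<in>carrier G. conjugate G g H = K)"
proof
  assume "orbit G (conjugate G) H = orbit G (conjugate G) K"
  moreover have "K \<in> orbit G (conjugate G) K"
    unfolding orbit_def using conjugate_one[OF K] one_closed by fastforce
  ultimately have "K \<in> orbit G (conjugate G) H" by simp
  then show "\<exists>g\<in>carrier G. conjugate G g H = K" unfolding orbit_def by auto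
next
  assume "\<exists>g\<in>carrier G. conjugate G g H = K"
  then obtain g where g: "g \<in> carrier G" "K = conjugate G g H" by auto
  then have back_conj: "conjugate G (inv g) K = H"
    using H by (simp add: conjugate_conjugate conjugate_one)
  have sub: "orbit G (conjugate G) B \<subseteq> orbit G (conjugate G) A"
    if "x \<in> carrier G" "B = conjugate G x A" "A \<subseteq> carrier G" for x A B
  proof
    fix C assume "C \<in> orbit G (conjugate G) B"
    then obtain y where "y \<in> carrier G" "C = conjugate G y B" unfolding orbit_def by auto
    then have "C = conjugate G (y \<otimes> x) A" "y \<otimes> x \<in> carrier G"
      using that by (simp_all add: conjugate_conjugate)
    then show "C \<in> orbit G (conjugate G) A" unfolding orbit_def by auto
  qed
  show "orbit G (conjugate G) H = orbit G (conjugate G) K"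
    using sub[OF g H] sub[OF _ back_conj[symmetric] K] g(1) by auto
qed

section \<open>Diagonalisation of roots of the identity matrix\<close>
definition diag_matrix :: "'a::zero^'n \<Rightarrow> 'a^'n^'n" where
  "diag_matrix d = (\<chi> i j. if i = j then d $ i else 0)"

lemma diag_matrix_mult_left: "diag_matrix d ** A = (\<chi> i j. d $ i * A $ i $ j)"
  for A :: "'a::comm_semiring_1^'n^'n"
  unfolding matrix_matrix_mult_def diag_matrix_def
  by (simp add: vec_eq_iff if_distrib if_distribR sum.delta'[OF finite] cong: if_cong)

lemma diag_matrix_mult_right: "A ** diag_matrix d = (\<chi> i j. A $ i $ j * d $ j)"
  for A :: "'a::comm_semiring_1^'n^'n"
  unfolding matrix_matrix_mult_def diag_matrix_def
  by (simp add: vec_eq_iff if_distrib if_distribR sum.delta'[OF finite] cong: if_cong)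

lemma diag_matrix_vector: "diag_matrix d *v v = (\<chi> i. d $ i * v $ i)"
  for v :: "'a::comm_semiring_1^'n"
  unfolding matrix_vector_mult_def diag_matrix_def
  by (simp add: vec_eq_iff if_distrib if_distribR sum.delta'[OF finite] cong: if_cong)

lemma diag_matrix_mult: "diag_matrix d ** diag_matrix e = diag_matrix (\<chi> i. d $ i * e $ i)"
  for d :: "'a::comm_semiring_1^'n"
  unfolding diag_matrix_mult_left by (auto simp: diag_matrix_def vec_eq_iff)

lemma mat_mult_diag_matrix: "mat c ** diag_matrix d = diag_matrix (\<chi> i. c * d $ i)"
  for d :: "complex^'n"
  unfolding mat_mult_left by (auto simp: diag_matrix_def vec_eq_iff)

lemma invertible_diag_matrix:
  fixes d :: "'a::field^'n"
  assumes "\<And>i. d $ i \<noteq> 0"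
  shows "invertible (diag_matrix d)"
proof -
  have "diag_matrix (\<chi> i. inverse (d $ i)) ** diag_matrix d = mat 1"
    unfolding diag_matrix_mult using assms by (auto simp: diag_matrix_def mat_def vec_eq_iff)
  then show ?thesis unfolding invertible_left_inverse by blast
qed

text \<open>Eigenvectors span because the identity is a sum of projections onto eigenspaces: for a \<open>p\<close>-th
  root of unity \<open>z\<close>, the average of \<open>z\<^sup>-\<^sup>i A\<^sup>i\<close> over \<open>i < p\<close> maps into the eigenspace of \<open>z\<close>, and these
  averages add up to the identity by orthogonality of the powers of roots of unity.\<close>
lemma span_eigenvectors_of_root:
  fixes A :: "complex^'n^'n" and p :: nat
  assumes inv: "invertible A" and pow: "A [^]\<^bsub>GL\<^esub> p = mat 1" and p: "p > 0"
  shows "vec.span {v. \<exists>z. z ^ p = 1 \<and> A *v v = z *s v} = UNIV"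
proof -
  interpret group "GL :: (complex^'n^'n) monoid" by (rule group_GL)
  define R where "R = {z::complex. z ^ p = 1}"
  have fin: "finite R" and cardR: "card R = p"
    unfolding R_def using p by (auto intro: finite_roots_unity card_roots_unity_eq)
  define x where "x v i = (A [^]\<^bsub>GL\<^esub> (i::nat)) *v v" for v i
  have x0: "x v 0 = v" and xp: "x v p = v" and xS: "A *v x v i = x v (Suc i)" for v i
  proof -
    show "x v 0 = v" "x v p = v" by (simp_all add: x_def pow)
    have "A [^]\<^bsub>GL\<^esub> (Suc i) = A ** A [^]\<^bsub>GL\<^esub> i"
      using nat_pow_Suc2[of A i] inv by simp
    then show "A *v x v i = x v (Suc i)" by (simp add: x_def matrix_vector_mul_assoc)
  qed
  \<comment> \<open>\<open>p\<close> times the projection onto the eigenspace of \<open>z\<close>\<close>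
  define P where "P z v = (\<Sum>i<p. inverse z ^ i *s x v i)" for z v
  have eig: "A *v P z v = z *s P z v" if "z \<in> R" for z v
  proof -
    have z: "z \<noteq> 0" "inverse z ^ p = 1" using that p
      by (auto simp: R_def power_0_left power_inverse)
    have "A *v P z v = (\<Sum>i<p. inverse z ^ i *s x v (Suc i))"
      unfolding P_def vec.linear_sum[OF matrix_vector_mul_linear_gen]
      by (simp add: vec.scale xS)
    also have "\<dots> = (\<Sum>i<p. z *s (inverse z ^ Suc i *s x v (Suc i)))"
      using z by (simp add: mult.assoc[symmetric])
    also have "\<dots> = z *s (\<Sum>i<p. inverse z ^ Suc i *s x v (Suc i))"
      by (simp add: vec.scale_sum_right)
    also have "(\<Sum>i<p. inverse z ^ Suc i *s x v (Suc i)) = P z v"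
      unfolding P_def
      using sum.lessThan_Suc_shift[of "\<lambda>i. inverse z ^ i *s x v i" p] z
      by (simp add: x0 xp)
    finally show ?thesis .
  qed
  have total: "(\<Sum>z\<in>R. P z v) = of_nat p *s v" for v
  proof -
    \<comment> \<open>multiplying the summation variable by a root \<open>w\<close> with \<open>w\<^sup>i \<noteq> 1\<close> rescales the sum, so it vanishes\<close>
    have van: "(\<Sum>z\<in>R. inverse z ^ i) = 0" if i: "0 < i" "i < p" for i
    proof -
      \<comment> \<open>such a \<open>w\<close> exists, as only \<open>i < p\<close> numbers satisfy \<open>z\<^sup>i = 1\<close>\<close>
      have "\<not> R \<subseteq> {z. z ^ i = 1}"
      proof
        assume "R \<subseteq> {z. z ^ i = 1}"
        then have "card R \<le> card {z::complex. z ^ i = 1}"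
          using i by (intro card_mono finite_roots_unity) auto
        also have "\<dots> = i" using i by (intro card_roots_unity_eq) auto
        finally show False using cardR i by simp
      qed
      then obtain w where w: "w \<in> R" "w ^ i \<noteq> 1" by auto
      then have w0: "w \<noteq> 0" using p by (auto simp: R_def power_0_left)
      have "bij_betw (\<lambda>z. w * z) R R"
        by (rule bij_betwI[where g = "\<lambda>z. z / w"])
           (use w w0 in \<open>auto simp: R_def power_mult_distrib power_divide\<close>)
      then have "(\<Sum>z\<in>R. inverse z ^ i) = (\<Sum>z\<in>R. inverse (w * z) ^ i)"
        by (rule sum.reindex_bij_betw[symmetric])
      also have "\<dots> = inverse w ^ i * (\<Sum>z\<in>R. inverse z ^ i)"
        by (simp add: power_mult_distrib sum_distrib_left)
      finally have "(1 - inverse w ^ i) * (\<Sum>z\<in>R. inverse z ^ i) = 0"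
        by (simp add: algebra_simps)
      then show ?thesis using w w0 by (auto simp: power_inverse)
    qed
    have "(\<Sum>z\<in>R. P z v) = (\<Sum>i<p. \<Sum>z\<in>R. inverse z ^ i *s x v i)"
      unfolding P_def by (rule sum.swap)
    also have "\<dots> = (\<Sum>i<p. (\<Sum>z\<in>R. inverse z ^ i) *s x v i)"
      by (simp add: vec.scale_sum_left)
    also have "\<dots> = (\<Sum>i<p. if i = 0 then of_nat p *s v else 0)"
      by (intro sum.cong) (use van cardR in \<open>auto simp: x0\<close>)
    finally show ?thesis using p by simp
  qed
  have "v \<in> vec.span {v. \<exists>z. z ^ p = 1 \<and> A *v v = z *s v}" for v
  proof -
    have "v = (1 / of_nat p) *s (\<Sum>z\<in>R. P z v)"
      unfolding total using p by (simp add: vec.scale_scale)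
    moreover have "P z v \<in> vec.span {v. \<exists>z. z ^ p = 1 \<and> A *v v = z *s v}" if "z \<in> R" for z
      using eig[OF that] that by (intro vec.span_base) (auto simp: R_def)
    ultimately show ?thesis
      by (metis (no_types, lifting) vec.span_scale vec.span_sum)
  qed
  then show ?thesis by blast
qed

text \<open>A basis chosen among the eigenvectors supplies the columns of \<open>Q\<close>.\<close>
lemma diagonalization_of_root:
  fixes A :: "complex^'n^'n" and p :: nat
  assumes "invertible A" "A [^]\<^bsub>GL\<^esub> p = mat 1" "p > 0"
  obtains Q :: "complex^'n^'n" and d where "invertible Q" "A ** Q = Q ** diag_matrix d" "\<And>i. d $ i ^ p = 1"
proof -
  define E where "E = {v. \<exists>z. z ^ p = 1 \<and> A *v v = z *s v}"
  have "vec.span E = UNIV" unfolding E_def by (rule span_eigenvectors_of_root[OF assms])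
  then obtain B where B: "B \<subseteq> E" "vec.independent B" "vec.span B = UNIV"
    by (metis top.extremum_uniqueI vec.maximal_independent_subset vec.span_minimal vec.subspace_span)
  have "card B = CARD('n)" using B vec.dim_eq_card[of B UNIV] vec.dim_UNIV
    by (simp add: card_cart_basis)
  then obtain f where f: "bij_betw f (UNIV :: 'n set) B"
    using finite_same_card_bij[of "UNIV :: 'n set" B] vec.finiteI_independent[OF B(2)] by auto
  have "\<forall>i. \<exists>z. z ^ p = 1 \<and> A *v f i = z *s f i"
    using f B(1) unfolding E_def bij_betw_def by blast
  then obtain z where z: "\<And>i. z i ^ p = 1" "\<And>i. A *v f i = z i *s f i" by metis
  define Q :: "complex^'n^'n" where "Q = (\<chi> i j. f j $ i)"
  have col: "column j Q = f j" for j by (simp add: column_def Q_def vec_eq_iff)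
  have "columns Q = B" unfolding columns_def col using f by (auto simp: bij_betw_def)
  then have "invertible Q"
    unfolding invertible_right_inverse matrix_right_invertible_span_columns using B by simp
  moreover have "A ** Q = Q ** diag_matrix (\<chi> i. z i)"
  proof -
    have "(A ** Q) $ i $ j = (Q ** diag_matrix (\<chi> i. z i)) $ i $ j" for i j
    proof -
      have "(A ** Q) $ i $ j = (A *v f j) $ i"
        by (simp add: matrix_matrix_mult_def matrix_vector_mult_def Q_def)
      then show ?thesis by (simp add: z diag_matrix_mult_right Q_def)
    qed
    then show ?thesis by (simp add: vec_eq_iff)
  qed
  ultimately show ?thesis using that[of Q "\<chi> i. z i"] z(1) by simp
qed

section \<open>Roots of unity\<close>

text \<open>Integer exponents make the exponent arithmetic that of residues modulo \<open>p\<close>.\<close>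
definition unity_root :: "nat \<Rightarrow> int \<Rightarrow> complex" where
  "unity_root p k = cis (2 * pi * of_int k / of_nat p)"

lemma unity_root_0 [simp]: "unity_root p 0 = 1"
  and unity_root_nonzero [simp]: "unity_root p k \<noteq> 0"
  and norm_unity_root [simp]: "norm (unity_root p k) = 1"
  by (simp_all add: unity_root_def)

lemma unity_root_add: "unity_root p (j + k) = unity_root p j * unity_root p k"
  by (simp add: unity_root_def cis_mult ring_distribs add_divide_distrib)

lemma unity_root_diff: "unity_root p (j - k) = unity_root p j / unity_root p k"
  by (simp add: unity_root_def cis_divide right_diff_distrib diff_divide_distrib)

lemma unity_root_eq_1_iff:
  assumes "p > 0"
  shows "unity_root p k = 1 \<longleftrightarrow> int p dvd k"
proof
  assume "unity_root p k = 1"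
  then obtain n :: int where "2 * pi * of_int k / of_nat p = of_int (2 * n) * pi"
    by (auto simp: unity_root_def cis_conv_exp exp_eq_1)
  then have "real_of_int k = real_of_int (n * int p)"
    using assms by (simp add: field_simps)
  then have "k = n * int p" by linarith
  then show "int p dvd k" by simp
next
  assume "int p dvd k"
  then obtain n where "k = int p * n" by (auto elim: dvdE)
  then have "2 * pi * of_int k / of_nat p = 2 * pi * of_int n" using assms by simp
  then show "unity_root p k = 1" unfolding unity_root_def by (metis cis_multiple_2pi Ints_of_int)
qed

lemma unity_root_eq_iff:
  assumes "p > 0"
  shows "unity_root p j = unity_root p k \<longleftrightarrow> int p dvd j - k"
  using unity_root_eq_1_iff[OF assms, of "j - k"] by (simp add: unity_root_diff)

lemma unity_root_exists:
  assumes "z ^ p = 1" "p > 0"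
  obtains k where "z = unity_root p k"
proof -
  have "z \<in> (\<lambda>k. cis (2 * pi * real k / real p)) ` {..<p}"
    using Complex.bij_betw_roots_unity[OF assms(2)] assms(1) by (auto simp: bij_betw_def)
  then obtain k where "z = cis (2 * pi * real k / real p)" by auto
  then show ?thesis using that[of "int k"] by (simp add: unity_root_def)
qed

text \<open>The reason why three points of an orbit are never collinear. On the unit circle conjugation
  is inversion, so conjugating the hypothesis divides its two sides by \<open>u y\<close> and \<open>v x\<close>
  respectively; as the common value is nonzero, these two divisors agree.\<close>
lemma unit_circle_cross_ratio:
  fixes u v x y :: complex
  assumes norm: "norm u = 1" "norm v = 1" "norm x = 1" "norm y = 1"
    and ne: "u \<noteq> 1" "y \<noteq> 1" and eq: "(u - 1) * (y - 1) = (v - 1) * (x - 1)"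
  shows "u * y = v * x"
proof -
  have inv: "cnj z = 1 / z" if "norm z = 1" for z
    using that by (metis complex_norm_square div_by_1 mult.commute nonzero_eq_divide_eq norm_eq_zero
        of_real_1 one_power2 zero_neq_one)
  have ne0: "u \<noteq> 0" "v \<noteq> 0" "x \<noteq> 0" "y \<noteq> 0" using norm by auto
  have "cnj ((u - 1) * (y - 1)) = cnj ((v - 1) * (x - 1))" using eq by simp
  then have "(1 / u - 1) * (1 / y - 1) = (1 / v - 1) * (1 / x - 1)"
    by (simp add: inv norm)
  moreover have "(1 / u - 1) * (1 / y - 1) = (u - 1) * (y - 1) / (u * y)"
    "(1 / v - 1) * (1 / x - 1) = (v - 1) * (x - 1) / (v * x)"
    using ne0 by (auto simp: field_simps)
  ultimately have "(u - 1) * (y - 1) / (u * y) = (u - 1) * (y - 1) / (v * x)"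
    using eq by simp
  moreover have "c = d" if "a / c = a / d" "a \<noteq> 0" "c \<noteq> 0" "d \<noteq> 0" for a c d :: complex
    using that by (simp add: field_simps)
  ultimately show ?thesis using ne ne0 by (metis mult_eq_0_iff right_minus_eq)
qed

section \<open>Diagonal subgroups of prime order and their orbits\<close>

text \<open>With \<open>\<zeta>\<close> a primitive \<open>p\<close>-th root of unity, these are the vectors \<open>(1, \<zeta>\<^sup>k, \<zeta>\<^sup>b\<^sup>k)\<close>: they serve both as
  the diagonals of the elements of a cyclic group and as the orbit of \<open>(1, 1, 1)\<close> under it.\<close>
definition orbit_vec :: "nat \<Rightarrow> int \<Rightarrow> int \<Rightarrow> complex^3" where
  "orbit_vec p b k = vector [1, unity_root p k, unity_root p (b * k)]"

definition std_elem :: "nat \<Rightarrow> int \<Rightarrow> int \<Rightarrow> complex^3^3" where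
  "std_elem p b k = diag_matrix (orbit_vec p b k)"

definition std_subgroup :: "nat \<Rightarrow> int \<Rightarrow> (complex^3^3) set set" where
  "std_subgroup p b = range (\<lambda>k. proj_class (std_elem p b k))"

lemma orbit_vec_nonzero: "orbit_vec p b k $ i \<noteq> 0"
  using exhaust_3[of i] by (auto simp: orbit_vec_def)

lemma invertible_std_elem [simp]: "invertible (std_elem p b k)"
  unfolding std_elem_def by (intro invertible_diag_matrix orbit_vec_nonzero)

lemma std_elem_mult: "std_elem p b j ** std_elem p b k = std_elem p b (j + k)"
  unfolding std_elem_def diag_matrix_mult
  by (rule arg_cong[of _ _ diag_matrix])
     (simp add: vec_eq_iff forall_3 orbit_vec_def unity_root_add ring_distribs)

lemma std_elem_vec: "std_elem p b k *v orbit_vec p b j = orbit_vec p b (k + j)"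
  unfolding std_elem_def diag_matrix_vector
  by (simp add: vec_eq_iff forall_3 orbit_vec_def unity_root_add ring_distribs)

lemma orbit_vec_cong:
  assumes "p > 0" "int p dvd j - k"
  shows "orbit_vec p b j = orbit_vec p b k"
proof -
  have "int p dvd b * j - b * k" using assms(2) by (simp add: right_diff_distrib[symmetric])
  then have "unity_root p j = unity_root p k" "unity_root p (b * j) = unity_root p (b * k)"
    using assms by (simp_all add: unity_root_eq_iff)
  then show ?thesis by (simp only: orbit_vec_def)
qed

text \<open>The first diagonal entry is \<open>1\<close> throughout, so a scalar relating two of these matrices is \<open>1\<close>.\<close>
lemma proj_class_std_elem_eq_iff:
  assumes "p > 0"
  shows "proj_class (std_elem p b j) = proj_class (std_elem p b k) \<longleftrightarrow> int p dvd j - k"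
proof
  assume "proj_class (std_elem p b j) = proj_class (std_elem p b k)"
  then obtain c where "std_elem p b j = mat c ** std_elem p b k"
    unfolding proj_class_eq_iff by blast
  then have eq: "std_elem p b j $ i $ i = c * std_elem p b k $ i $ i" for i
    by (simp add: mat_mult_left)
  have "c = 1" using eq[of 1] by (simp add: std_elem_def diag_matrix_def orbit_vec_def)
  then have "unity_root p j = unity_root p k"
    using eq[of 2] by (simp add: std_elem_def diag_matrix_def orbit_vec_def)
  then show "int p dvd j - k" using assms by (simp add: unity_root_eq_iff)
next
  assume "int p dvd j - k"
  then show "proj_class (std_elem p b j) = proj_class (std_elem p b k)"
    unfolding std_elem_def using orbit_vec_cong[OF assms] by simp
qed

lemma std_hom: "(\<lambda>k. proj_class (std_elem p b k)) \<in> hom integer_group PGL"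
  by (intro homI) (auto simp: carrier_PGL proj_class_mult std_elem_mult)

lemma std_subgroup_subgroup: "subgroup (std_subgroup p b) PGL"
proof -
  have "group_hom integer_group PGL (\<lambda>k. proj_class (std_elem p b k))"
    using std_hom group_PGL by (simp add: group_hom_def group_hom_axioms_def)
  from group_hom.img_is_subgroup[OF this] show ?thesis by (simp add: std_subgroup_def)
qed

lemma std_subgroup_pow: "std_subgroup p b = range (\<lambda>n::int. proj_class (std_elem p b 1) [^]\<^bsub>PGL\<^esub> n)"
proof -
  have "proj_class (std_elem p b n) = proj_class (std_elem p b 1) [^]\<^bsub>PGL\<^esub> n" for n :: int
    using hom_int_pow[OF std_hom _ group_integer_group group_PGL, of 1 p b n] by simp
  then show ?thesis unfolding std_subgroup_def by (rule image_cong[OF refl])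
qed

lemma std_subgroup_cyclic: "cyclic_group (PGL\<lparr>carrier := std_subgroup p b\<rparr>)"
proof -
  have "(\<lambda>k. proj_class (std_elem p b k)) \<in> epi integer_group (PGL\<lparr>carrier := std_subgroup p b\<rparr>)"
    using std_hom[of p b] by (auto simp: epi_def hom_def std_subgroup_def)
  then show ?thesis
    by (rule group.cyclic_group_epimorphic_image[OF group_integer_group])
       (auto intro: subgroup.subgroup_is_group[OF std_subgroup_subgroup group_PGL])
qed

lemma std_subgroup_card:
  assumes "p > 0"
  shows "card (std_subgroup p b) = p"
proof -
  have "bij_betw (\<lambda>k. proj_class (std_elem p b k)) {0..<int p} (std_subgroup p b)"
    unfolding bij_betw_def
  proof
    show "inj_on (\<lambda>k. proj_class (std_elem p b k)) {0..<int p}"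
      using assms by (auto simp: inj_on_def proj_class_std_elem_eq_iff mod_eq_dvd_iff[symmetric])
    have "proj_class (std_elem p b k) = proj_class (std_elem p b (k mod int p))" for k
      using assms by (subst proj_class_std_elem_eq_iff) (auto simp: mod_eq_dvd_iff[symmetric])
    moreover have "k mod int p \<in> {0..<int p}" for k using assms by simp
    ultimately have "proj_class (std_elem p b k) \<in> (\<lambda>k. proj_class (std_elem p b k)) ` {0..<int p}" for k
      by (metis (no_types, lifting) image_eqI)
    then show "(\<lambda>k. proj_class (std_elem p b k)) ` {0..<int p} = std_subgroup p b"
      unfolding std_subgroup_def by auto
  qed
  then show ?thesis using bij_betw_same_card by fastforce
qed

lemma span_eq_UNIV_if_det:
  fixes u v w :: "complex^3"
  assumes "det (vector [u, v, w] :: complex^3^3) \<noteq> 0"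
  shows "vec.span {u, v, w} = UNIV"
proof -
  have "invertible (vector [u, v, w] :: complex^3^3)" using assms by (simp add: invertible_det_nz)
  moreover have "rows (vector [u, v, w] :: complex^3^3) = range (($) (vector [u, v, w] :: complex^3^3))"
    unfolding rows_def row_def by (auto simp: vec_lambda_eta)
  then have "rows (vector [u, v, w] :: complex^3^3) = {u, v, w}"
    by (simp add: UNIV_3)
  ultimately show ?thesis
    using matrix_left_invertible_span_rows_gen[of "vector [u, v, w] :: complex^3^3"]
    by (simp add: invertible_left_inverse)
qed

text \<open>After dividing the coordinates of all three vectors by those of the first, the determinant vanishes iff
  \<open>(u - 1) (y - 1) = (v - 1) (x - 1)\<close>, where \<open>x = u\<^sup>b\<close> and \<open>y = v\<^sup>b\<close>. Being on the unit circle then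
  forces \<open>u v\<^sup>b = v u\<^sup>b\<close>, that is, \<open>(b - 1) (j - k)\<close> vanishes modulo \<open>p\<close>. For minors of size
  three this is an elementary proof of Chebotarev's theorem on minors of the Fourier matrix.\<close>
lemma det_orbit_vec:
  fixes p :: nat
  assumes p: "prime p" and b: "\<not> int p dvd b" "\<not> int p dvd b - 1"
    and ij: "\<not> int p dvd j - i" and ik: "\<not> int p dvd k - i" and jk: "\<not> int p dvd j - k"
  shows "det (vector [orbit_vec p b i, orbit_vec p b j, orbit_vec p b k] :: complex^3^3) \<noteq> 0"
proof
  define e where "e = unity_root p"
  have p0: "p > 0" using p prime_gt_0_nat by blast
  have prm: "int p dvd x * y \<Longrightarrow> int p dvd x \<or> int p dvd y" for x y
    using p prime_dvd_mult_iff[of "int p"] by simp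
  define u where "u = e (j - i)"
  define v where "v = e (k - i)"
  define x where "x = e (b * (j - i))"
  define y where "y = e (b * (k - i))"
  have e: "e j = e i * u" "e k = e i * v" "e (b * j) = e (b * i) * x" "e (b * k) = e (b * i) * y"
    unfolding u_def v_def x_def y_def e_def
    by (simp_all add: unity_root_add[symmetric] algebra_simps)
  assume "det (vector [orbit_vec p b i, orbit_vec p b j, orbit_vec p b k] :: complex^3^3) = 0"
  then have "e i * e (b * i) * ((u - 1) * (y - 1) - (v - 1) * (x - 1)) = 0"
    unfolding det_3 orbit_vec_def e_def[symmetric] by (simp add: e algebra_simps)
  then have eq: "(u - 1) * (y - 1) = (v - 1) * (x - 1)" by (simp add: e_def)
  have u1: "u \<noteq> 1" unfolding u_def e_def using ij p0 by (simp add: unity_root_eq_1_iff)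
  have y1: "y \<noteq> 1"
    unfolding y_def e_def using ik b(1) p0 prm by (auto simp: unity_root_eq_1_iff)
  have "u * y = v * x"
    by (rule unit_circle_cross_ratio[OF _ _ _ _ u1 y1 eq])
       (simp_all add: u_def v_def x_def y_def e_def)
  then have "e ((j - i) + b * (k - i)) = e ((k - i) + b * (j - i))"
    unfolding u_def v_def x_def y_def e_def unity_root_add .
  then have "int p dvd ((j - i) + b * (k - i)) - ((k - i) + b * (j - i))"
    unfolding e_def using p0 by (simp add: unity_root_eq_iff)
  also have "((j - i) + b * (k - i)) - ((k - i) + b * (j - i)) = - ((b - 1) * (j - k))"
    by (simp add: algebra_simps)
  finally show False using prm b(2) jk by (metis dvd_minus_iff)
qed

text \<open>A set of at most three indices extends to one with three elements, where the determinant
  decides.\<close>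
lemma orbit_vec_independent:
  fixes p :: nat
  assumes p: "prime p" "p > 3" and b: "\<not> int p dvd b" "\<not> int p dvd b - 1"
    and I: "I \<subseteq> {0..<int p}" "card I \<le> 3"
  shows "vec.independent (orbit_vec p b ` I)" "inj_on (orbit_vec p b) I"
proof -
  obtain J where J: "I \<subseteq> J" "J \<subseteq> {0..<int p}" "card J = 3"
    using exists_subset_between[of I 3 "{0..<int p}"] I p by auto
  obtain i j k where ijk: "J = {i, j, k}" "i \<noteq> j" "i \<noteq> k" "j \<noteq> k"
    using J(3) by (auto simp: card_3_iff)
  have dvd: "\<not> int p dvd a - c" if "a \<in> J" "c \<in> J" "a \<noteq> c" for a c
  proof -
    have "a \<in> {0..<int p}" "c \<in> {0..<int p}" using that J(2) by blast+
    then show ?thesis using that(3) by (auto simp: mod_eq_dvd_iff[symmetric])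
  qed
  have "vec.span {orbit_vec p b i, orbit_vec p b j, orbit_vec p b k} = UNIV"
    by (intro span_eq_UNIV_if_det det_orbit_vec p b dvd) (use ijk in auto)
  then have span: "vec.span (orbit_vec p b ` J) = UNIV" by (simp add: ijk)
  have fin: "finite (orbit_vec p b ` J)" by (simp add: ijk)
  have dim3: "vec.dim (UNIV :: (complex^3) set) = 3" by (simp add: card_cart_basis)
  then have "3 \<le> card (orbit_vec p b ` J)"
    using vec.dim_le_card[OF _ fin, of UNIV] span by simp
  moreover have "card (orbit_vec p b ` J) \<le> 3" using card_image_le[of J "orbit_vec p b"] J(3) by (simp add: ijk(1))
  ultimately have card: "card (orbit_vec p b ` J) = 3" by simp
  then have "inj_on (orbit_vec p b) J" using J(3) ijk by (intro eq_card_imp_inj_on) auto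
  then show "inj_on (orbit_vec p b) I" using J(1) inj_on_subset by blast
  have "vec.independent (orbit_vec p b ` J)"
    using vec.card_eq_dim[of "orbit_vec p b ` J" UNIV] card dim3 fin span by simp
  then show "vec.independent (orbit_vec p b ` I)"
    using J(1) vec.independent_mono by blast
qed

text \<open>All integers are allowed as indices although only residues modulo \<open>p\<close> matter: invariance under
  the group is then invariance of the integers under translation.\<close>
definition std_orbit :: "nat \<Rightarrow> int \<Rightarrow> (complex^3) set set" where
  "std_orbit p b = range (\<lambda>k. vec.span {orbit_vec p b k})"

lemma std_orbit_eq:
  assumes "p > 0"
  shows "std_orbit p b = (\<lambda>k. vec.span {orbit_vec p b k}) ` {0..<int p}"
proof -
  have "orbit_vec p b k = orbit_vec p b (k mod int p)" for k
    by (intro orbit_vec_cong[OF assms]) (simp add: mod_eq_dvd_iff[symmetric])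
  moreover have "k mod int p \<in> {0..<int p}" for k using assms by simp
  ultimately have "vec.span {orbit_vec p b k} \<in> (\<lambda>k. vec.span {orbit_vec p b k}) ` {0..<int p}" for k
    by (metis (no_types, lifting) image_eqI)
  then show ?thesis unfolding std_orbit_def by auto
qed

lemma inj_on_std_orbit:
  fixes p :: nat
  assumes "prime p" "p > 3" "\<not> int p dvd b" "\<not> int p dvd b - 1"
  shows "inj_on (\<lambda>k. vec.span {orbit_vec p b k}) {0..<int p}"
proof (rule inj_onI, rule ccontr)
  fix i j assume ij: "i \<in> {0..<int p}" "j \<in> {0..<int p}" "i \<noteq> j"
    and eq: "vec.span {orbit_vec p b i} = vec.span {orbit_vec p b j}"
  have I: "{i, j} \<subseteq> {0..<int p}" "card {i, j} \<le> 3" using ij by simp_all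
  note ind = orbit_vec_independent[OF assms I]
  have "card (orbit_vec p b ` {i, j}) = 2" using card_image[OF ind(2)] ij by simp
  then have "vec.dim (orbit_vec p b ` {i, j}) = 2"
    using vec.dim_eq_card_independent[OF ind(1)] by simp
  moreover have "orbit_vec p b ` {i, j} \<subseteq> vec.span {orbit_vec p b j}"
    using eq vec.span_base[of "orbit_vec p b i" "{orbit_vec p b i}"]
      vec.span_base[of "orbit_vec p b j" "{orbit_vec p b j}"] by auto
  then have "vec.dim (orbit_vec p b ` {i, j}) \<le> 1"
    using vec.dim_le_card[of "orbit_vec p b ` {i, j}" "{orbit_vec p b j}"] by simp
  ultimately show False by simp
qed

lemma general_position_std_orbit:
  fixes p :: nat
  assumes "prime p" "p > 3" "\<not> int p dvd b" "\<not> int p dvd b - 1"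
  shows "general_position (std_orbit p b)"
  unfolding general_position_def
proof (intro conjI allI impI)
  have p0: "p > 0" using assms by simp
  show "std_orbit p b \<subseteq> proj_space"
  proof -
    have "orbit_vec p b k \<noteq> 0" for k using orbit_vec_nonzero[of p b k 1] by auto
    then show ?thesis unfolding std_orbit_def proj_space_def by auto
  qed
  fix S assume S: "S \<subseteq> std_orbit p b" "finite S \<and> card S \<le> CARD(3)"
  then obtain I where I: "I \<subseteq> {0..<int p}" "S = (\<lambda>k. vec.span {orbit_vec p b k}) ` I"
    unfolding std_orbit_eq[OF p0] by (metis subset_imageE)
  have "inj_on (\<lambda>k. vec.span {orbit_vec p b k}) I"
    using inj_on_std_orbit[OF assms] I(1) inj_on_subset by blast
  then have card: "card S = card I" using I by (simp add: card_image)
  then have "card I \<le> 3" using S by simp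
  note ind = orbit_vec_independent[OF assms I(1) this]
  have "vec.span (\<Union>S) = vec.span (orbit_vec p b ` I)"
  proof (rule vec.span_eq[THEN iffD2], intro conjI)
    show "\<Union>S \<subseteq> vec.span (orbit_vec p b ` I)"
      unfolding I(2) by (auto intro: vec.span_mono[THEN subsetD, rotated])
    show "orbit_vec p b ` I \<subseteq> vec.span (\<Union>S)"
      unfolding I(2) by (auto intro!: vec.span_base)
  qed
  then show "vec.dim (vec.span (\<Union>S)) = card S"
    using vec.dim_span_eq_card_independent[OF ind(1)] card_image[OF ind(2)] card by simp
qed

text \<open>The orbit of the point \<open>[1 : 1 : 1]\<close> has \<open>p \<ge> 5\<close> points and is in general position.\<close>
lemma std_subgroup_admissible:
  fixes p :: nat
  assumes p: "prime p" "p > 3" and b: "\<not> int p dvd b" "\<not> int p dvd b - 1"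
  shows "admissible (std_subgroup p b)"
  unfolding admissible_def
proof (intro conjI exI)
  have p0: "p > 0" using p by simp
  show "subgroup (std_subgroup p b) PGL" by (rule std_subgroup_subgroup)
  show "finite (std_subgroup p b)" using std_subgroup_card[OF p0, of b] p0 card_gt_0_iff by metis
  show "finite (std_orbit p b)" unfolding std_orbit_eq[OF p0] by simp
  have "card (std_orbit p b) = p"
    unfolding std_orbit_eq[OF p0] using card_image[OF inj_on_std_orbit[OF assms]] by simp
  moreover have "p \<noteq> 4" using p by auto
  ultimately show "CARD(3) + 2 \<le> card (std_orbit p b)" using p by simp
  show gp: "general_position (std_orbit p b)" by (rule general_position_std_orbit[OF assms])
  show "std_subgroup p b \<subseteq> Aut (std_orbit p b)"
  proof
    fix f assume "f \<in> std_subgroup p b"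
    then obtain k where f: "f = proj_class (std_elem p b k)" unfolding std_subgroup_def by auto
    have "proj_act f (vec.span {orbit_vec p b j}) = vec.span {orbit_vec p b (k + j)}" for j
    proof -
      have "vec.span {orbit_vec p b j} \<in> proj_space"
        using gp unfolding general_position_def std_orbit_def by auto
      then have "proj_act f (vec.span {orbit_vec p b j}) = (*v) (std_elem p b k) ` vec.span {orbit_vec p b j}"
        unfolding f proj_class_def by (rule proj_act_coset)
      also have "\<dots> = vec.span ((*v) (std_elem p b k) ` {orbit_vec p b j})"
        using vec.linear_span_image[OF matrix_vector_mul_linear_gen] by metis
      finally show ?thesis by (simp add: std_elem_vec)
    qed
    then have "proj_act f ` std_orbit p b = range (\<lambda>j. vec.span {orbit_vec p b (k + j)})"
      unfolding std_orbit_def image_image by simp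
    also have "\<dots> = (\<lambda>j. vec.span {orbit_vec p b j}) ` range (\<lambda>j. k + j)"
      by (rule image_image[symmetric])
    also have "range (\<lambda>j. k + j) = UNIV" by (rule surj_plus)
    finally have "proj_act f ` std_orbit p b = std_orbit p b" unfolding std_orbit_def .
    moreover have "f \<in> carrier PGL" unfolding f carrier_PGL by simp
    ultimately show "f \<in> Aut (std_orbit p b)" unfolding Aut_def by simp
  qed
qed

section \<open>Anharmonic classes modulo a prime\<close>

text \<open>For \<open>b\<close> other than \<open>0\<close> and \<open>1\<close> modulo a prime \<open>p\<close>, the six alternatives express that \<open>c\<close> is one of \<open>b\<close>, \<open>1 - b\<close>, \<open>1 / b\<close>, \<open>1 - 1 / b\<close>, \<open>1 / (1 - b)\<close>,
  \<open>b / (b - 1)\<close>, the values of a cross ratio under permutations of its arguments. Cleared of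
  denominators they are visibly symmetric in \<open>b\<close> and \<open>c\<close>.\<close>
definition anharmonic :: "int \<Rightarrow> int \<Rightarrow> int \<Rightarrow> bool" where
  "anharmonic p b c \<longleftrightarrow> [b = c] (mod p) \<or> [b + c = 1] (mod p) \<or> [b * c = 1] (mod p) \<or>
     [b * (1 - c) = 1] (mod p) \<or> [(1 - b) * c = 1] (mod p) \<or> [(1 - b) * (1 - c) = 1] (mod p)"

lemma eq_if_cong:
  fixes p :: int
  assumes "b \<in> {2..<p}" "c \<in> {2..<p}" "p dvd b - c"
  shows "b = c"
  using assms by (metis atLeastLessThan_iff cong_iff_dvd_diff cong_less_imp_eq_int order_trans zero_le_numeral)

text \<open>Representatives are taken between \<open>2\<close> and \<open>p - 1\<close>, i.e. among the residues other than \<open>0\<close> and \<open>1\<close>.\<close>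
lemma exists_representative:
  fixes p x :: int
  assumes "p > 1" "\<not> p dvd x" "\<not> p dvd x - 1"
  shows "\<exists>y\<in>{2..<p}. p dvd y - x"
proof (intro bexI)
  show "p dvd x mod p - x" by (simp add: mod_eq_dvd_iff[symmetric])
  have "x mod p \<noteq> 0" "x mod p \<noteq> 1" using assms
    by (auto simp: dvd_eq_mod_eq_0) (metis assms(1,3) mod_eq_dvd_iff mod_pos_pos_trivial zero_le_one)
  moreover have "0 \<le> x mod p" "x mod p < p" using assms by auto
  ultimately show "x mod p \<in> {2..<p}" by simp
qed

lemma exists_reciprocal:
  fixes p x :: int
  assumes "prime p" "\<not> p dvd x" "\<not> p dvd x - 1"
  shows "\<exists>y\<in>{2..<p}. p dvd x * y - 1"
proof -
  have "coprime x p" using assms prime_imp_coprime coprime_commute by blast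
  then obtain z where z: "p dvd x * z - 1"
    using cong_solve_coprime_int cong_iff_dvd_diff by blast
  have "\<not> p dvd z"
  proof
    assume "p dvd z"
    then have "p dvd 1" using z by algebra
    then show False using assms(1) not_prime_unit by blast
  qed
  moreover have "\<not> p dvd z - 1"
  proof
    assume "p dvd z - 1"
    then have "p dvd x - 1" using z by algebra
    then show False using assms by simp
  qed
  ultimately obtain y where "y \<in> {2..<p}" "p dvd y - z"
    using exists_representative[of p z] prime_gt_1_int[OF assms(1)] by blast
  moreover from this have "p dvd x * y - 1" using z by algebra
  ultimately show ?thesis by blast
qed

lemma anharmonic_iff_dvd:
  "anharmonic p b c \<longleftrightarrow> p dvd c - b \<or> p dvd c - (1 - b) \<or> p dvd b * c - 1 \<or>
     p dvd b * (1 - c) - 1 \<or> p dvd (1 - b) * c - 1 \<or> p dvd (1 - b) * (1 - c) - 1"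
proof -
  have "p dvd b - c \<longleftrightarrow> p dvd c - b" by (rule dvd_diff_commute)
  moreover have "b + c - 1 = c - (1 - b)" by simp
  ultimately show ?thesis unfolding anharmonic_def cong_iff_dvd_diff by metis
qed

text \<open>With \<open>b'\<close>, \<open>u\<close>, \<open>w\<close> the residues of \<open>1 - b\<close>, \<open>1 / b\<close>, \<open>1 / (1 - b)\<close> and \<open>u'\<close>, \<open>w'\<close> those of \<open>1 - u\<close> and \<open>1 - w\<close>, an
  equality between any two of the six values is one of the congruences excluded by the hypotheses.\<close>
lemma card_anharmonic_class:
  fixes p b :: int
  assumes p: "prime p" "p > 3" and b: "b \<in> {2..<p}"
    and gen: "\<not> p dvd b + 1" "\<not> p dvd b - 2" "\<not> p dvd 2 * b - 1" "\<not> p dvd b * b - b + 1"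
  shows "card {c \<in> {2..<p}. anharmonic p b c} = 6"
proof -
  have nb: "\<not> p dvd b" "\<not> p dvd b - 1"
    using b zdvd_not_zless[of b p] zdvd_not_zless[of "b - 1" p] by auto
  then have nb': "\<not> p dvd 1 - b" "\<not> p dvd (1 - b) - 1" "\<not> p dvd - b"
    by (simp_all add: dvd_diff_commute)
  have p1: "\<not> p dvd 1" using p not_prime_unit by blast
  obtain b' where b': "b' \<in> {2..<p}" "p dvd b' - (1 - b)"
    using exists_representative[of p "1 - b"] nb' p by auto
  obtain u where u: "u \<in> {2..<p}" "p dvd b * u - 1"
    using exists_reciprocal[of p b] nb p by auto
  obtain w where w: "w \<in> {2..<p}" "p dvd (1 - b) * w - 1"
    using exists_reciprocal[of p "1 - b"] nb' p by auto
  have rep: "\<exists>y\<in>{2..<p}. p dvd y - (1 - x)" if "x \<in> {2..<p}" for x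
    using that zdvd_not_zless[of "x - 1" p] zdvd_not_zless[of x p] exists_representative[of p "1 - x"] p(2)
    by (auto simp: dvd_diff_commute[of p 1 x])
  obtain u' where u': "u' \<in> {2..<p}" "p dvd u' - (1 - u)" using rep u by blast
  obtain w' where w': "w' \<in> {2..<p}" "p dvd w' - (1 - w)" using rep w by blast
  have prm: "p dvd x * y \<Longrightarrow> p dvd x \<or> p dvd y" for x y
    using p(1) prime_dvd_mult_iff by blast
  have cancel: "p dvd c - d" if "p dvd a * c - 1" "p dvd a * d - 1" for a c d
  proof -
    have "p dvd a * (c - d)" using that by algebra
    moreover have "\<not> p dvd a"
    proof
      assume "p dvd a"
      then have "p dvd 1" using that by algebra
      then show False using p1 by simp
    qed
    ultimately show ?thesis using prm by blast
  qed
  have "{c \<in> {2..<p}. anharmonic p b c} = {b, b', u, u', w, w'}"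
  proof (intro equalityI subsetI)
    fix c assume c: "c \<in> {c \<in> {2..<p}. anharmonic p b c}"
    then consider "p dvd c - b" | "p dvd c - (1 - b)" | "p dvd b * c - 1"
      | "p dvd b * (1 - c) - 1" | "p dvd (1 - b) * c - 1" | "p dvd (1 - b) * (1 - c) - 1"
      unfolding anharmonic_iff_dvd by blast
    then have "p dvd c - b \<or> p dvd c - b' \<or> p dvd c - u \<or> p dvd c - u' \<or> p dvd c - w \<or> p dvd c - w'"
    proof cases
      case 2 then have "p dvd c - b'" using b' by algebra
      then show ?thesis by blast
    next
      case 3 then show ?thesis using cancel[OF 3 u(2)] by blast
    next
      case 4 then have "p dvd c - u'" using cancel[OF 4 u(2)] u' by algebra
      then show ?thesis by blast
    next
      case 5 then show ?thesis using cancel[OF 5 w(2)] by blast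
    next
      case 6 then have "p dvd c - w'" using cancel[OF 6 w(2)] w' by algebra
      then show ?thesis by blast
    qed blast
    then show "c \<in> {b, b', u, u', w, w'}"
      using eq_if_cong[of c p] c b b'(1) u(1) u'(1) w(1) w'(1) by blast
  next
    fix c assume "c \<in> {b, b', u, u', w, w'}"
    moreover have "p dvd b * (1 - u') - 1" using u u' by algebra
    moreover have "p dvd (1 - b) * (1 - w') - 1" using w w' by algebra
    moreover have "p dvd b - b" by simp
    ultimately show "c \<in> {c \<in> {2..<p}. anharmonic p b c}"
      using b b' u u' w w' unfolding anharmonic_iff_dvd by blast
  qed
  moreover have "distinct [b, b', u, u', w, w']"
  proof -
    have c1: "p dvd 2 * b - 1" if "b = b'" using b'(2) that by algebra
    have "p dvd (b + 1) * (b - 1)" if "b = u" using u(2) that by algebra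
    then have c2: "b \<noteq> u" using prm gen nb by blast
    have c3: "p dvd b * b - b + 1" if "b = u'" using u u' that by algebra
    have c4: "p dvd b * b - b + 1" if "b = w" using w that by algebra
    have "p dvd b * (b - 2)" if "b = w'" using w w' that by algebra
    then have c5: "b \<noteq> w'" using prm gen nb by blast
    have c6: "p dvd b * b - b + 1" if "b' = u" using b' u that by algebra
    have "p dvd (b + 1) * (b - 1)" if "b' = u'" using b' u u' that by algebra
    then have c7: "b' \<noteq> u'" using prm gen nb by blast
    have "p dvd b * (b - 2)" if "b' = w" using b' w that by algebra
    then have c8: "b' \<noteq> w" using prm gen nb by blast
    have c9: "p dvd b * b - b + 1" if "b' = w'" using b' w w' that by algebra
    have c10: "p dvd b - 2" if "u = u'" using u u' that by algebra
    have c11: "p dvd 2 * b - 1" if "u = w" using u w that by algebra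
    have c12: "p dvd b * b - b + 1" if "u = w'" using u w w' that by algebra
    have c13: "p dvd b * b - b + 1" if "u' = w" using u u' w that by algebra
    have c14: "p dvd 2 * b - 1" if "u' = w'" using u u' w w' that by algebra
    have c15: "p dvd b + 1" if "w = w'" using w w' that by algebra
    show ?thesis using gen c1 c2 c3 c4 c5 c6 c7 c8 c9 c10 c11 c12 c13 c14 c15 by auto
  qed
  ultimately show ?thesis using distinct_card[of "[b, b', u, u', w, w']"] by simp
qed

text \<open>The six transformations permute the harmonic cross ratios \<open>-1\<close>, \<open>2\<close> and \<open>1 / 2\<close>. The case distinction
  applies each transformation to each of these values.\<close>
lemma anharmonic_class_harmonic:
  fixes p b :: int
  assumes p: "prime p" "p > 3" and b: "b \<in> {2..<p}"
    and special: "p dvd b + 1 \<or> p dvd b - 2 \<or> p dvd 2 * b - 1"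
  shows "{c \<in> {2..<p}. anharmonic p b c} = {p - 1, 2, (p + 1) div 2}"
proof -
  define h where "h = (p + 1) div 2"
  have "even (p + 1)" using p prime_odd_int by auto
  then have h: "2 * h = p + 1" unfolding h_def by (rule dvd_mult_div_cancel)
  then have hF: "h \<in> {2..<p}" using p by auto
  have prm: "p dvd x * y \<Longrightarrow> p dvd x \<or> p dvd y" for x y
    using p(1) prime_dvd_mult_iff by blast
  have n2: "\<not> p dvd 2" using p zdvd_not_zless[of 2 p] by auto
  have ph: "p dvd 2 * h - 1" using h by simp
  have pm: "p dvd (p - 1) + 1" by simp
  have char_h: "c = h" if "c \<in> {2..<p}" "p dvd 2 * c - 1" for c
  proof -
    have "p dvd 2 * (c - h)" using that(2) ph by algebra
    then have "p dvd c - h" using prm n2 by blast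
    then show ?thesis using eq_if_cong that hF by blast
  qed
  have char_m: "c = p - 1" if "c \<in> {2..<p}" "p dvd c + 1" for c
    using eq_if_cong[of c p "p - 1"] that p by (simp add: dvd_diff_left_iff algebra_simps)
  have char_2: "c = 2" if "c \<in> {2..<p}" "p dvd c - 2" for c
    using eq_if_cong[of c p 2] that p by simp
  have "anharmonic p b c \<longleftrightarrow> p dvd c + 1 \<or> p dvd c - 2 \<or> p dvd 2 * c - 1" for c
  proof
    assume "anharmonic p b c"
    then consider "p dvd c - b" | "p dvd c - (1 - b)" | "p dvd b * c - 1"
      | "p dvd b * (1 - c) - 1" | "p dvd (1 - b) * c - 1" | "p dvd (1 - b) * (1 - c) - 1"
      unfolding anharmonic_iff_dvd by blast
    note anh = this
    from special consider "p dvd b + 1" | "p dvd b - 2" | "p dvd 2 * b - 1" by blast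
    then show "p dvd c + 1 \<or> p dvd c - 2 \<or> p dvd 2 * c - 1"
    proof cases
      case 1
      from anh show ?thesis
      proof cases
        case other: 1 then have "p dvd c + 1" using 1 by algebra then show ?thesis by blast
      next
        case 2 then have "p dvd c - 2" using 1 by algebra then show ?thesis by blast
      next
        case 3 then have "p dvd c + 1" using 1 by algebra then show ?thesis by blast
      next
        case 4 then have "p dvd c - 2" using 1 by algebra then show ?thesis by blast
      next
        case 5 then have "p dvd 2 * c - 1" using 1 by algebra then show ?thesis by blast
      next
        case 6 then have "p dvd 2 * c - 1" using 1 by algebra then show ?thesis by blast
      qed
    next
      case 2
      from anh show ?thesis
      proof cases
        case 1 then have "p dvd c - 2" using 2 by algebra then show ?thesis by blast
      next
        case other: 2 then have "p dvd c + 1" using 2 by algebra then show ?thesis by blast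
      next
        case 3 then have "p dvd 2 * c - 1" using 2 by algebra then show ?thesis by blast
      next
        case 4 then have "p dvd 2 * c - 1" using 2 by algebra then show ?thesis by blast
      next
        case 5 then have "p dvd c + 1" using 2 by algebra then show ?thesis by blast
      next
        case 6 then have "p dvd c - 2" using 2 by algebra then show ?thesis by blast
      qed
    next
      case 3
      from anh show ?thesis
      proof cases
        case 1 then have "p dvd 2 * c - 1" using 3 by algebra then show ?thesis by blast
      next
        case 2 then have "p dvd 2 * c - 1" using 3 by algebra then show ?thesis by blast
      next
        case other: 3 then have "p dvd c - 2" using 3 by algebra then show ?thesis by blast
      next
        case 4 then have "p dvd c + 1" using 3 by algebra then show ?thesis by blast
      next
        case 5 then have "p dvd c - 2" using 3 by algebra then show ?thesis by blast
      next
        case 6 then have "p dvd c + 1" using 3 by algebra then show ?thesis by blast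
      qed
    qed
  next
    assume c: "p dvd c + 1 \<or> p dvd c - 2 \<or> p dvd 2 * c - 1"
    from special consider "p dvd b + 1" | "p dvd b - 2" | "p dvd 2 * b - 1" by blast
    then show "anharmonic p b c"
    proof cases
      case 1
      have "p dvd c - b" if "p dvd c + 1" using that 1 by algebra
      moreover have "p dvd c - (1 - b)" if "p dvd c - 2" using that 1 by algebra
      moreover have "p dvd (1 - b) * c - 1" if "p dvd 2 * c - 1"
        using dvd_diff[OF that dvd_mult[OF 1, of c]] by (simp add: algebra_simps)
      ultimately show ?thesis using c unfolding anharmonic_iff_dvd by blast
    next
      case 2
      have "p dvd c - (1 - b)" if "p dvd c + 1" using that 2 by algebra
      moreover have "p dvd c - b" if "p dvd c - 2" using that 2 by algebra
      moreover have "p dvd b * c - 1" if "p dvd 2 * c - 1"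
        using dvd_add[OF that dvd_mult[OF 2, of c]] by (simp add: algebra_simps)
      ultimately show ?thesis using c unfolding anharmonic_iff_dvd by blast
    next
      case 3
      have "p dvd b * (1 - c) - 1" if "p dvd c + 1" using that 3 by algebra
      moreover have "p dvd b * c - 1" if "p dvd c - 2" using that 3 by algebra
      moreover have "p dvd c - b" if "p dvd 2 * c - 1"
      proof -
        have "p dvd 2 * (c - b)" using that 3 by algebra
        then show ?thesis using prm n2 by blast
      qed
      ultimately show ?thesis using c unfolding anharmonic_iff_dvd by blast
    qed
  qed
  moreover have "p - 1 \<in> {2..<p}" "2 \<in> {2..<p}" "p dvd 2 - 2" using p by auto
  ultimately show ?thesis
    using char_h char_m char_2 ph pm hF unfolding h_def[symmetric] by blast
qed

text \<open>If \<open>b\<^sup>2 - b + 1 = 0\<close> then \<open>1 / b = 1 - b\<close>, so the six values reduce to \<open>b\<close> and \<open>1 - b\<close>, which are all the roots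
  of this quadratic.\<close>
lemma anharmonic_class_equianharmonic:
  fixes p b :: int
  assumes p: "prime p" and b: "b \<in> {2..<p}" and special: "p dvd b * b - b + 1"
  shows "{c \<in> {2..<p}. anharmonic p b c} = {c \<in> {2..<p}. p dvd c * c - c + 1}"
proof -
  have "anharmonic p b c \<longleftrightarrow> p dvd c * c - c + 1" for c
  proof
    assume "anharmonic p b c"
    then consider "p dvd c - b" | "p dvd c - (1 - b)" | "p dvd b * c - 1"
      | "p dvd b * (1 - c) - 1" | "p dvd (1 - b) * c - 1" | "p dvd (1 - b) * (1 - c) - 1"
      unfolding anharmonic_iff_dvd by blast
    then show "p dvd c * c - c + 1"
      by cases (use special in algebra)+
  next
    assume "p dvd c * c - c + 1"
    then have "p dvd (c - b) * (c - (1 - b))" using special by algebra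
    then show "anharmonic p b c"
      unfolding anharmonic_iff_dvd using p prime_dvd_mult_iff by blast
  qed
  then show ?thesis by simp
qed

text \<open>The two roots differ because the discriminant of \<open>X\<^sup>2 - X + 1\<close> is \<open>-3\<close>, a unit modulo \<open>p\<close>.\<close>
lemma card_equianharmonic_class:
  fixes p b :: int
  assumes p: "prime p" "p > 3" and b: "b \<in> {2..<p}" and special: "p dvd b * b - b + 1"
  shows "card {c \<in> {2..<p}. p dvd c * c - c + 1} = 2"
proof -
  have "\<not> p dvd 1 - b" "\<not> p dvd (1 - b) - 1"
    using b zdvd_not_zless[of b p] zdvd_not_zless[of "b - 1" p]
    by (auto simp: dvd_diff_commute)
  then obtain b' where b': "b' \<in> {2..<p}" "p dvd b' - (1 - b)"
    using exists_representative[of p "1 - b"] p by auto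
  have "b \<noteq> b'"
  proof
    assume "b = b'"
    then have "p dvd 2 * b - 1" using b'(2) by (simp add: algebra_simps)
    \<comment> \<open>completing the square: this difference is the constant \<open>3\<close>\<close>
    then have "p dvd 4 * (b * b - b + 1) - (2 * b - 1) * (2 * b - 1)"
      by (rule dvd_diff[OF dvd_mult[OF special] dvd_mult])
    then have "p dvd 3" by (simp add: algebra_simps)
    then show False using p zdvd_not_zless[of 3 p] by simp
  qed
  moreover have "{c \<in> {2..<p}. p dvd c * c - c + 1} = {b, b'}"
  proof (intro equalityI subsetI)
    fix c assume c: "c \<in> {c \<in> {2..<p}. p dvd c * c - c + 1}"
    then have "p dvd (c - b) * (c - b')" using special b'(2) by algebra
    then have "p dvd c - b \<or> p dvd c - b'" using p prime_dvd_mult_iff by blast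
    then show "c \<in> {b, b'}" using eq_if_cong c b b'(1) by blast
  next
    have "p dvd b' * b' - b' + 1" using b' special by algebra
    then show "c \<in> {b, b'} \<Longrightarrow> c \<in> {c \<in> {2..<p}. p dvd c * c - c + 1}" for c
      using b b' special by auto
  qed
  ultimately show ?thesis by simp
qed

text \<open>Phrased through a function \<open>h\<close> whose fibres are the classes, so that it applies to any complete
  invariant without a separate proof that the relation is an equivalence. There is
  one class of size three, at most one of size two (\<open>e\<close> counts it), and \<open>m\<close> of size six; adding
  the sizes up to \<open>p - 2\<close> relates \<open>e\<close> and \<open>m\<close>.\<close>
lemma card_anharmonic_classes:
  fixes p :: nat and h :: "int \<Rightarrow> 'a"
  assumes p: "prime p" "p > 3"
    and h: "\<And>b c. b \<in> {2..<int p} \<Longrightarrow> c \<in> {2..<int p} \<Longrightarrow> h b = h c \<longleftrightarrow> anharmonic (int p) b c"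
  shows "\<exists>e m. e \<le> 1 \<and> p - 2 = 3 + 2 * e + 6 * m \<and> card (h ` {2..<int p}) = 1 + e + m"
proof -
  define F where "F = {2..<int p}"
  \<comment> \<open>the residues of \<open>-1\<close>, \<open>2\<close> and \<open>1 / 2\<close>\<close>
  define S where "S = {int p - 1, 2, (int p + 1) div 2}"
  define E where "E = {c \<in> F. int p dvd c * c - c + 1}"
  define C where "C b = {c \<in> F. anharmonic (int p) b c}" for b
  have pi: "prime (int p)" "int p > 3" using p by auto
  have C_eq: "C b = {c \<in> F. h c = h b}" if "b \<in> F" for b
    unfolding C_def using h that unfolding F_def by metis
  have self: "b \<in> C b" if "b \<in> F" for b using that C_eq by simp
  have C_inj: "C b = C c \<longleftrightarrow> h b = h c" if "b \<in> F" "c \<in> F" for b c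
    using C_eq self that by auto
  have "odd p" using p prime_odd_nat by auto
  then have S3: "card S = 3" unfolding S_def using p by (auto elim!: oddE)
  have trichotomy: "C b = S \<or> (C b = E \<and> card E = 2) \<or> card (C b) = 6" if "b \<in> F" for b
    using that anharmonic_class_harmonic[OF pi, of b] anharmonic_class_equianharmonic[OF pi(1), of b]
      card_equianharmonic_class[OF pi, of b] card_anharmonic_class[OF pi, of b]
    unfolding C_def S_def E_def F_def by blast
  have S_mem: "S \<in> C ` F"
  proof
    show "2 \<in> F" using p by (simp add: F_def)
    then show "S = C 2" using anharmonic_class_harmonic[OF pi, of 2]
      unfolding C_def S_def F_def by simp
  qed
  define X6 where "X6 = {D \<in> C ` F. card D = 6}"
  define X2 where "X2 = {D \<in> C ` F. D = E \<and> card E = 2}"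
  have fin: "finite (C ` F)" "finite X6" "finite X2" by (simp_all add: X6_def X2_def F_def)
  have split: "C ` F = {S} \<union> X2 \<union> X6" using trichotomy S_mem unfolding X6_def X2_def by auto
  have disj: "{S} \<inter> X2 = {}" "({S} \<union> X2) \<inter> X6 = {}" using S3 unfolding X6_def X2_def by auto
  define e where "e = card X2"
  define m where "m = card X6"
  have "X2 \<subseteq> {E}" unfolding X2_def by blast
  then have e1: "e \<le> 1" unfolding e_def using card_mono[of "{E}" X2] by simp
  have sum_split: "sum f (C ` F) = f S + sum f X2 + sum f X6" for f :: "int set \<Rightarrow> nat"
    unfolding split using fin disj by (simp add: sum.union_disjoint)
  have "card (C ` F) = 1 + e + m"
    using sum_split[of "\<lambda>_. 1"] by (simp add: e_def m_def)
  moreover have "p - 2 = 3 + 2 * e + 6 * m"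
  proof -
    have "p - 2 = card F" by (simp add: F_def)
    also have "\<dots> = card (\<Union> (C ` F))"
      using self by (intro arg_cong[of _ _ card]) (auto simp: C_def)
    also have "\<dots> = sum card (C ` F)"
    proof (rule card_Union_disjoint)
      show "pairwise disjnt (C ` F)"
        unfolding pairwise_def disjnt_def using C_eq by fastforce
      show "finite D" if "D \<in> C ` F" for D
        using that by (auto simp: C_def F_def intro: finite_subset[of _ "{2..<int p}"])
    qed
    also have "\<dots> = card S + sum card X2 + sum card X6" by (rule sum_split)
    also have "sum card X2 = sum (\<lambda>_. 2) X2" by (rule sum.cong) (auto simp: X2_def)
    also have "sum card X6 = sum (\<lambda>_. 6) X6" by (rule sum.cong) (auto simp: X6_def)
    finally show ?thesis by (simp add: S3 e_def m_def)
  qed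
  moreover have "card (h ` F) = card (C ` F)"
  proof -
    define k where "k D = h (SOME b. b \<in> D)" for D
    have k: "k (C b) = h b" if "b \<in> F" for b
      using someI[of "\<lambda>x. x \<in> C b", OF self[OF that]] C_eq[OF that] unfolding k_def by simp
    have "bij_betw k (C ` F) (h ` F)"
      unfolding bij_betw_def inj_on_def using k C_inj by (auto simp: image_iff)
    then show ?thesis by (rule bij_betw_same_card[symmetric])
  qed
  ultimately show ?thesis using e1 unfolding F_def by metis
qed

section \<open>Generators of admissible groups have distinct eigenvalues\<close>

text \<open>The hypothesis on \<open>r\<close> and \<open>w\<close> says that \<open>A - r\<close> has rank at most one, i.e. that \<open>A\<close> is scalar or acts as a
  homology or elation. All points in the orbit of \<open>[v]\<close> then lie on the line through \<open>[v]\<close> and \<open>[w]\<close>, and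
  an orbit of odd length other than \<open>1\<close> has at least three points, contradicting general position.
  Hence every point of \<open>T\<close> is fixed; at most one of them is \<open>[w]\<close>, and the others lie in the
  eigenspace of \<open>r\<close>. Three of these span the whole space.\<close>
lemma scalar_if_rank_one_deviation:
  fixes A :: "complex^3^3" and w :: "complex^3" and p :: nat
  assumes inv: "invertible A" and pow: "A [^]\<^bsub>GL\<^esub> p = mat 1" and p: "odd p"
    and rank: "\<And>v. \<exists>a. A *v v = r *s v + a *s w"
    and T: "finite T" "card T \<ge> 5" "general_position T" "(`) ((*v) A) ` T = T"
  shows "A = mat r"
proof -
  define \<phi> where "\<phi> L = (*v) A ` L" for L :: "(complex^3) set"
  have T_sub: "T \<subseteq> proj_space" using T(3) by (simp add: general_position_def)
  have gen: "vec.dim (\<Union>S) = 3" if "S \<subseteq> T" "card S = 3" for S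
    using that T(3) by (simp add: general_position_def card_ge_0_finite)
  have injA: "inj ((*v) A)"
    using inv by (simp add: invertible_left_inverse matrix_left_invertible_injective)
  have inj: "\<phi> L = \<phi> M \<Longrightarrow> L = M" for L M
    unfolding \<phi>_def using injA by (simp add: inj_image_eq_iff)
  have \<phi>T: "\<phi> L \<in> T" if "L \<in> T" for L using T(4) that unfolding \<phi>_def by blast
  have line: "\<exists>v. v \<noteq> 0 \<and> L = vec.span {v}" if "L \<in> T" for L
  proof -
    have L: "vec.subspace L" "vec.dim L = 1" using T_sub that by (auto simp: proj_space_def)
    obtain B where B: "B \<subseteq> L" "vec.independent B" "L \<subseteq> vec.span B" "card B = 1"
      using vec.basis_exists[of L] L(2) by metis
    then obtain v where v: "B = {v}" by (auto simp: card_1_singleton_iff)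
    then have "v \<noteq> 0" using B(2) by auto
    moreover have "L = vec.span {v}" using B(1,3) v vec.span_minimal[OF _ L(1)] by blast
    ultimately show ?thesis by blast
  qed
  have fixed: "\<phi> L = L" if L: "L \<in> T" for L
  proof (rule ccontr)
    assume ne: "\<phi> L \<noteq> L"
    have pow_\<phi>: "(\<phi> ^^ n) M = (*v) (A [^]\<^bsub>GL\<^esub> n) ` M" for n M
    proof (induction n)
      case (Suc n)
      have "A [^]\<^bsub>GL\<^esub> (Suc n) = A ** A [^]\<^bsub>GL\<^esub> n"
        using monoid.nat_pow_Suc2[OF group.is_monoid[OF group_GL], of A n] inv by simp
      moreover have "(\<phi> ^^ Suc n) M = (*v) A ` (*v) (A [^]\<^bsub>GL\<^esub> n) ` M"
        unfolding Suc[symmetric] \<phi>_def[symmetric] by simp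
      ultimately show ?case by (simp add: image_image matrix_vector_mul_assoc)
    qed simp
    \<comment> \<open>otherwise the odd power \<open>p\<close> of the action, which is the identity, would agree with \<open>\<phi>\<close> on \<open>L\<close>\<close>
    have "\<phi> (\<phi> L) \<noteq> L"
    proof
      assume two: "\<phi> (\<phi> L) = L"
      have even: "(\<phi> ^^ (2 * n)) L = L" for n by (induction n) (simp_all add: two)
      from p obtain n where "p = Suc (2 * n)" by (auto elim: oddE)
      then have "(\<phi> ^^ p) L = \<phi> L" using even by simp
      then show False using ne by (simp add: pow_\<phi> pow)
    qed
    moreover have "\<phi> (\<phi> L) \<noteq> \<phi> L" using ne inj by blast
    ultimately have "card {L, \<phi> L, \<phi> (\<phi> L)} = 3" using ne by auto
    then have dim3: "vec.dim (\<Union>{L, \<phi> L, \<phi> (\<phi> L)}) = 3" using \<phi>T L by (intro gen) auto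
    obtain v where v: "L = vec.span {v}" using line[OF L] by blast
    have span_vw: "\<phi> M \<subseteq> vec.span {v, w}" if M: "M \<subseteq> vec.span {v, w}" for M
    proof
      fix y assume "y \<in> \<phi> M"
      then obtain x where x: "x \<in> vec.span {v, w}" "y = A *v x" using M unfolding \<phi>_def by auto
      obtain a where "A *v x = r *s x + a *s w" using rank by blast
      then show "y \<in> vec.span {v, w}"
        using x by (simp add: vec.span_add vec.span_scale vec.span_base)
    qed
    have "L \<subseteq> vec.span {v, w}" unfolding v by (rule vec.span_mono) simp
    then have "\<Union>{L, \<phi> L, \<phi> (\<phi> L)} \<subseteq> vec.span {v, w}" using span_vw by auto
    then have "vec.dim (\<Union>{L, \<phi> L, \<phi> (\<phi> L)}) \<le> card {v, w}" by (intro vec.dim_le_card) auto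
    also have "\<dots> \<le> 2" by (simp add: card_insert_if)
    finally show False using dim3 by simp
  qed
  have eigen: "A *v v = r *s v" if L: "L \<in> T" "L \<noteq> vec.span {w}" "v \<in> L" for L v
  proof -
    have sub: "vec.subspace L" using T_sub L(1) by (auto simp: proj_space_def)
    obtain a where a: "A *v v = r *s v + a *s w" using rank by blast
    show ?thesis
    proof (cases "a *s w = 0")
      case False
      have "A *v v \<in> L" using fixed[OF L(1)] L(3) unfolding \<phi>_def by blast
      then have "A *v v - r *s v \<in> L"
        using vec.subspace_diff[OF sub] vec.subspace_scale[OF sub L(3)] by blast
      then have "a *s w \<in> L" by (simp add: a)
      moreover have "a \<noteq> 0" "w \<noteq> 0" using False by auto
      ultimately have wL: "w \<in> L"
        using vec.subspace_scale[OF sub, of "a *s w" "1 / a"] by (simp add: vec.scale_scale)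
      obtain u where "L = vec.span {u}" using line[OF L(1)] by blast
      then have "vec.span {w} = L"
        using wL \<open>w \<noteq> 0\<close> vec.subspace_dim_equal[of "vec.span {w}" L] sub T_sub L(1)
          vec.span_minimal[of "{w}" L]
        by (auto simp: proj_space_def)
      then show ?thesis using L(2) by simp
    qed (simp add: a)
  qed
  have "3 \<le> card (T - {vec.span {w}})" using T(1,2) by (auto simp: card_Diff_singleton_if)
  then obtain S where S: "S \<subseteq> T - {vec.span {w}}" "card S = 3"
    by (meson obtain_subset_with_card_n)
  define K where "K = {v. A *v v = r *s v}"
  have K: "vec.subspace K"
    unfolding K_def vec.subspace_def
    by (simp add: vec.add vec.scale matrix_vector_right_distrib vec.scale_right_distrib
        vec.scale_left_commute)
  have "\<Union>S \<subseteq> K" unfolding K_def using S(1) eigen by blast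
  moreover have "vec.dim (\<Union>S) = 3" using gen S by blast
  ultimately have "vec.dim K \<ge> 3" using vec.dim_subset[of "\<Union>S" K] by simp
  moreover have "vec.dim (UNIV :: (complex^3) set) = 3" by (simp add: card_cart_basis)
  ultimately have "K = UNIV" using vec.subspace_dim_equal[OF K vec.subspace_UNIV] by simp
  then have "A *v v = mat r *v v" for v unfolding K_def mat_mult_vec by auto
  then show ?thesis by (simp add: matrix_eq)
qed

text \<open>If two of the three eigenvalues agree, only the remaining eigenvector \<open>column k Q\<close> contributes to
  the deviation of \<open>A\<close> from a scalar, so that deviation has rank at most one.\<close>
lemma distinct_eigenvalues_if_general_position:
  fixes A Q :: "complex^3^3" and p :: nat
  assumes inv: "invertible A" and pow: "A [^]\<^bsub>GL\<^esub> p = mat 1" and p: "odd p"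
    and Q: "invertible Q" "A ** Q = Q ** diag_matrix d"
    and T: "finite T" "card T \<ge> 5" "general_position T" "(`) ((*v) A) ` T = T"
    and nonscalar: "\<And>r. A \<noteq> mat r"
  shows "inj_on (($) d) UNIV"
proof (rule inj_onI, rule ccontr)
  fix i j :: 3
  assume ij: "d $ i = d $ j" "i \<noteq> j"
  obtain k where k: "\<And>l. l \<noteq> k \<Longrightarrow> l = i \<or> l = j"
    using exhaust_3[of i] exhaust_3[of j] ij(2) exhaust_3 by metis
  obtain R where R: "Q ** R = mat 1" "R ** Q = mat 1" using Q(1) unfolding invertible_def by blast
  define r where "r = d $ i"
  have "\<exists>a. A *v v = r *s v + a *s (column k Q)" for v
  proof
    define u where "u = R *v v"
    have v: "v = Q *v u" by (simp add: u_def matrix_vector_mul_assoc R)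
    have diag: "diag_matrix d *v u = r *s u + ((d $ k - r) * u $ k) *s axis k 1"
    proof -
      have "(diag_matrix d *v u) $ l = (r *s u + ((d $ k - r) * u $ k) *s axis k 1) $ l" for l
        using k[of l] ij by (cases "l = k") (auto simp: diag_matrix_vector r_def axis_def algebra_simps)
      then show ?thesis by (simp add: vec_eq_iff)
    qed
    have col: "Q *v axis k 1 = column k Q"
      by (simp add: matrix_vector_mult_def axis_def column_def vec_eq_iff if_distrib if_distribR
          sum.delta'[OF finite] cong: if_cong)
    have "A *v v = Q *v (diag_matrix d *v u)"
      by (simp add: v matrix_vector_mul_assoc Q(2))
    also have "\<dots> = r *s v + ((d $ k - r) * u $ k) *s column k Q"
      unfolding diag by (simp add: v vec.add vec.scale col)
    finally show "A *v v = r *s v + ((d $ k - r) * u $ k) *s column k Q" .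
  qed
  then show False using scalar_if_rank_one_deviation[OF inv pow p _ T] nonscalar by blast
qed

section \<open>Conjugacy classes of diagonal subgroups\<close>
lemma (in group) conjugation_hom:
  assumes "g \<in> carrier G"
  shows "(\<lambda>h. g \<otimes> h \<otimes> inv g) \<in> hom G G"
proof (rule homI)
  fix x y assume xy: "x \<in> carrier G" "y \<in> carrier G"
  have "inv g \<otimes> (g \<otimes> z) = z" if "z \<in> carrier G" for z
    using assms that by (simp add: m_assoc[symmetric])
  then show "g \<otimes> (x \<otimes> y) \<otimes> inv g = g \<otimes> x \<otimes> inv g \<otimes> (g \<otimes> y \<otimes> inv g)"
    using assms xy by (simp add: m_assoc)
qed (use assms in simp)

text \<open>The normal form depends only on the ratios of the eigenvalues. Since both groups have
  order \<open>p\<close>, it is enough that the conjugated generator lands in the standard group; it lands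
  on the power \<open>i\<close> of the standard generator, which \<open>b i = j\<close> modulo \<open>p\<close> expresses.\<close>
lemma conjugate_to_std:
  fixes A Q :: "complex^3^3" and p :: nat
  assumes p: "p > 0" and inv: "invertible A" and Q: "invertible Q" "A ** Q = Q ** diag_matrix d"
    and H: "H = range (\<lambda>n::int. proj_class A [^]\<^bsub>PGL\<^esub> n)" "card H = p"
    and d: "d $ 1 \<noteq> 0" "d $ 2 = d $ 1 * unity_root p i" "d $ 3 = d $ 1 * unity_root p j"
    and b: "int p dvd b * i - j"
  shows "\<exists>g\<in>carrier PGL. conjugate PGL g H = std_subgroup p b"
proof -
  interpret P: group "PGL :: (complex^3^3) set monoid" by (rule group_PGL)
  obtain R where R: "Q ** R = mat 1" "R ** Q = mat 1" using Q(1) unfolding invertible_def by blast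
  then have invR: "invertible R" unfolding invertible_def by blast
  define g where "g = proj_class R"
  have g: "g \<in> carrier PGL" unfolding g_def carrier_PGL using invR by blast
  have A: "proj_class A \<in> carrier PGL" unfolding carrier_PGL using inv by blast
  have inv_g: "inv\<^bsub>PGL\<^esub> g = proj_class Q"
    by (rule P.inv_equality) (use Q(1) invR R g in \<open>auto simp: g_def carrier_PGL proj_class_mult one_PGL\<close>)
  have "g \<otimes>\<^bsub>PGL\<^esub> proj_class A \<otimes>\<^bsub>PGL\<^esub> inv\<^bsub>PGL\<^esub> g = proj_class (R ** A ** Q)"
    unfolding inv_g unfolding g_def using invR inv Q(1) by (simp add: proj_class_mult invertible_mult)
  also have "R ** A ** Q = diag_matrix d"
    using Q(2) R(2) by (metis matrix_mul_assoc matrix_mul_lid)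
  also have "diag_matrix d = mat (d $ 1) ** std_elem p b i"
  proof -
    have "unity_root p (b * i) = unity_root p j" using p b by (simp add: unity_root_eq_iff)
    then have "d = (\<chi> l. d $ 1 * orbit_vec p b i $ l)"
      by (simp add: vec_eq_iff forall_3 orbit_vec_def d)
    then show ?thesis unfolding std_elem_def mat_mult_diag_matrix by metis
  qed
  also have "proj_class (mat (d $ 1) ** std_elem p b i) = proj_class (std_elem p b i)"
    using d(1) proj_class_eq_iff by blast
  finally have conj_A: "g \<otimes>\<^bsub>PGL\<^esub> proj_class A \<otimes>\<^bsub>PGL\<^esub> inv\<^bsub>PGL\<^esub> g = proj_class (std_elem p b i)" .
  have sub: "conjugate PGL g H \<subseteq> std_subgroup p b"
  proof
    fix h assume "h \<in> conjugate PGL g H"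
    then obtain n :: int where "h = g \<otimes>\<^bsub>PGL\<^esub> (proj_class A [^]\<^bsub>PGL\<^esub> n) \<otimes>\<^bsub>PGL\<^esub> inv\<^bsub>PGL\<^esub> g"
      unfolding P.conjugate_eq_image H(1) by auto
    also have "\<dots> = proj_class (std_elem p b i) [^]\<^bsub>PGL\<^esub> n"
      using hom_int_pow[OF P.conjugation_hom[OF g] A group_PGL group_PGL, of n] by (simp add: conj_A)
    also have "\<dots> \<in> std_subgroup p b"
      by (intro P.subgroup_int_pow_closed std_subgroup_subgroup) (simp add: std_subgroup_def)
    finally show "h \<in> std_subgroup p b" .
  qed
  have H_sub: "H \<subseteq> carrier PGL" unfolding H(1) using A by auto
  have "inj_on (\<lambda>h. g \<otimes>\<^bsub>PGL\<^esub> h \<otimes>\<^bsub>PGL\<^esub> inv\<^bsub>PGL\<^esub> g) H"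
    by (rule inj_onI, rule P.conjugation_is_inj[OF g]) (use H_sub in blast)+
  then have "card (conjugate PGL g H) = card (std_subgroup p b)"
    unfolding P.conjugate_eq_image using H(2) std_subgroup_card[OF p] by (simp add: card_image)
  moreover have "finite (std_subgroup p b)" using std_subgroup_card[OF p, of b] p card_gt_0_iff by metis
  ultimately show ?thesis using sub g by (metis card_subset_eq)
qed

abbreviation std_class :: "nat \<Rightarrow> int \<Rightarrow> (complex^3^3) set set set" where
  "std_class p b \<equiv> orbit PGL (conjugate PGL) (std_subgroup p b)"

lemma std_subgroup_carrier: "std_subgroup p b \<subseteq> carrier PGL"
  using std_subgroup_subgroup subgroup.subset by blast

lemma std_class_eq_iff:
  "std_class p b = std_class p c \<longleftrightarrow> (\<exists>g\<in>carrier PGL. conjugate PGL g (std_subgroup p b) = std_subgroup p c)"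
  by (rule group.orbit_conjugate_eq_iff[OF group_PGL std_subgroup_carrier std_subgroup_carrier])

lemma std_class_cong:
  assumes "p > 0" "int p dvd b - c"
  shows "std_class p b = std_class p c"
proof -
  have "orbit_vec p b k = orbit_vec p c k" for k
  proof -
    have "int p dvd b * k - c * k" using assms(2) by (simp add: left_diff_distrib[symmetric])
    then have "unity_root p (b * k) = unity_root p (c * k)" using assms by (simp add: unity_root_eq_iff)
    then show ?thesis by (simp only: orbit_vec_def)
  qed
  then have "std_subgroup p b = std_subgroup p c" by (simp add: std_subgroup_def std_elem_def)
  then show ?thesis by simp
qed

text \<open>Reordering the basis vectors by \<open>\<sigma>\<close> changes which eigenvalue is normalised to \<open>1\<close> and which to
  \<open>\<zeta>\<close>, hence the parameter, but not the conjugacy class.\<close>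
lemma std_class_permute:
  assumes p: "p > 0" and \<sigma>: "\<sigma> permutes (UNIV :: 3 set)"
    and d: "orbit_vec p b 1 $ \<sigma> 2 = orbit_vec p b 1 $ \<sigma> 1 * unity_root p i"
      "orbit_vec p b 1 $ \<sigma> 3 = orbit_vec p b 1 $ \<sigma> 1 * unity_root p j"
    and c: "int p dvd c * i - j"
  shows "std_class p b = std_class p c"
proof -
  define Q :: "complex^3^3" where "Q = (\<chi> i j. if i = \<sigma> j then 1 else 0)"
  define R :: "complex^3^3" where "R = (\<chi> i j. if j = \<sigma> i then 1 else 0)"
  have "(R ** Q) $ i $ j = (mat 1 :: complex^3^3) $ i $ j" for i j
  proof -
    have "(R ** Q) $ i $ j = (\<Sum>k\<in>UNIV. if k = \<sigma> i then (if \<sigma> i = \<sigma> j then 1 else 0) else 0)"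
      unfolding matrix_matrix_mult_def R_def Q_def vec_lambda_beta by (rule sum.cong) auto
    then show ?thesis using permutes_inj[OF \<sigma>] by (simp add: mat_def inj_eq)
  qed
  then have "R ** Q = mat 1" by (simp add: vec_eq_iff)
  then have "invertible Q" unfolding invertible_left_inverse by blast
  moreover have "std_elem p b 1 ** Q = Q ** diag_matrix (\<chi> l. orbit_vec p b 1 $ \<sigma> l)"
    unfolding std_elem_def diag_matrix_mult_left diag_matrix_mult_right by (simp add: Q_def vec_eq_iff)
  ultimately show ?thesis
    unfolding std_class_eq_iff
    using d std_subgroup_card[OF p] orbit_vec_nonzero
    by (intro conjugate_to_std[OF p invertible_std_elem _ _ std_subgroup_pow _ _ _ _ c]) auto
qed

text \<open>Exchanging the first two basis vectors turns the exponents \<open>0, 1, b\<close> into \<open>1, 0, b\<close>, which the affine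
  map \<open>x \<mapsto> 1 - x\<close> normalises to \<open>0, 1, 1 - b\<close>.\<close>
lemma std_class_complement:
  assumes "p > 0" "int p dvd b + c - 1"
  shows "std_class p b = std_class p c"
proof (rule std_class_permute)
  show "Transposition.transpose 1 2 permutes (UNIV :: 3 set)" by (rule permutes_swap_id) auto
  show "orbit_vec p b 1 $ Transposition.transpose 1 2 2 = orbit_vec p b 1 $ Transposition.transpose 1 2 1 * unity_root p (-1)"
    using unity_root_add[of p 1 "-1"] by (simp add: orbit_vec_def)
  show "orbit_vec p b 1 $ Transposition.transpose 1 2 3 = orbit_vec p b 1 $ Transposition.transpose 1 2 1 * unity_root p (b - 1)"
    using unity_root_add[of p 1 "b - 1"] by (simp add: orbit_vec_def transpose_def)
  have "c * -1 - (b - 1) = - (b + c - 1)" by simp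
  then show "int p dvd c * -1 - (b - 1)" using assms(2) by (simp only: dvd_minus_iff)
qed (rule assms)

text \<open>Exchanging the last two basis vectors turns the exponents \<open>0, 1, b\<close> into \<open>0, b, 1\<close>, which division by
  \<open>b\<close> normalises to \<open>0, 1, 1 / b\<close>.\<close>
lemma std_class_reciprocal:
  assumes "p > 0" "int p dvd b * c - 1"
  shows "std_class p b = std_class p c"
proof (rule std_class_permute)
  show "Transposition.transpose 2 3 permutes (UNIV :: 3 set)" by (rule permutes_swap_id) auto
  show "orbit_vec p b 1 $ Transposition.transpose 2 3 2 = orbit_vec p b 1 $ Transposition.transpose 2 3 1 * unity_root p b"
    by (simp add: orbit_vec_def transpose_def)
  show "orbit_vec p b 1 $ Transposition.transpose 2 3 3 = orbit_vec p b 1 $ Transposition.transpose 2 3 1 * unity_root p 1"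
    by (simp add: orbit_vec_def transpose_def)
  show "int p dvd c * b - 1" using assms(2) by (simp add: mult.commute)
qed (rule assms)

text \<open>The maps \<open>b \<mapsto> 1 - b\<close> and \<open>b \<mapsto> 1 / b\<close> generate the six anharmonic transformations.\<close>
lemma anharmonic_imp_std_class_eq:
  assumes p: "p > 0" and "anharmonic (int p) b c"
  shows "std_class p b = std_class p c"
proof -
  have comp: "std_class p x = std_class p (1 - x)" for x by (rule std_class_complement[OF p]) simp
  from assms(2) consider "int p dvd c - b" | "int p dvd c - (1 - b)" | "int p dvd b * c - 1"
    | "int p dvd b * (1 - c) - 1" | "int p dvd (1 - b) * c - 1" | "int p dvd (1 - b) * (1 - c) - 1"
    unfolding anharmonic_iff_dvd by blast
  then show ?thesis
  proof cases
    case 1 then show ?thesis using std_class_cong[OF p, of c b] by simp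
  next
    case 2 then show ?thesis using std_class_cong[OF p, of c "1 - b"] comp[of b] by simp
  next
    case 3 then show ?thesis by (rule std_class_reciprocal[OF p])
  next
    case 4 then show ?thesis using std_class_reciprocal[OF p, of b "1 - c"] comp[of c] by simp
  next
    case 5 then show ?thesis using std_class_reciprocal[OF p, of "1 - b" c] comp[of b] by simp
  next
    case 6 then show ?thesis
      using std_class_reciprocal[OF p, of "1 - b" "1 - c"] comp[of b] comp[of c] by simp
  qed
qed

lemma dvd_combination:
  fixes q :: int
  assumes "q dvd x" "q dvd y" "z = s * x + t * y"
  shows "q dvd z"
  using assms by simp

text \<open>A conjugating matrix \<open>Q\<close> intertwines two diagonal matrices up to a scalar \<open>r\<close>. Each column of \<open>Q\<close> has
  a nonzero entry, which matches an eigenvalue of one with \<open>r\<close> times an eigenvalue of the other. So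
  the exponents \<open>0, 1, b\<close> are, up to a translation modulo \<open>p\<close>, a rearrangement of \<open>0, m, c m\<close>. Eliminating
  \<open>m\<close> from the six possible rearrangements gives the six alternatives.\<close>
lemma std_class_eq_imp_anharmonic:
  fixes p :: nat
  assumes p: "prime p" and b: "\<not> int p dvd b" "\<not> int p dvd b - 1"
    and eq: "std_class p b = std_class p c"
  shows "anharmonic (int p) b c"
proof -
  interpret P: group "PGL :: (complex^3^3) set monoid" by (rule group_PGL)
  have p0: "p > 0" using p prime_gt_0_nat by blast
  have p1: "\<not> int p dvd 1" using p by auto
  obtain g where g: "g \<in> carrier PGL" "conjugate PGL g (std_subgroup p b) = std_subgroup p c"
    using eq unfolding std_class_eq_iff by blast
  obtain Q where Q: "invertible Q" "g = proj_class Q" using g(1) unfolding carrier_PGL by blast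
  have "proj_class (std_elem p b 1) \<in> std_subgroup p b" unfolding std_subgroup_def by blast
  then have "g \<otimes>\<^bsub>PGL\<^esub> proj_class (std_elem p b 1) \<otimes>\<^bsub>PGL\<^esub> inv\<^bsub>PGL\<^esub> g \<in> std_subgroup p c"
    unfolding g(2)[symmetric] P.conjugate_eq_image by blast
  then obtain m where "g \<otimes>\<^bsub>PGL\<^esub> proj_class (std_elem p b 1) \<otimes>\<^bsub>PGL\<^esub> inv\<^bsub>PGL\<^esub> g = proj_class (std_elem p c m)"
    unfolding std_subgroup_def by auto
  moreover have "proj_class (std_elem p b 1) \<in> carrier PGL" "proj_class (std_elem p c m) \<in> carrier PGL"
    unfolding carrier_PGL by auto
  ultimately have "g \<otimes>\<^bsub>PGL\<^esub> proj_class (std_elem p b 1) = proj_class (std_elem p c m) \<otimes>\<^bsub>PGL\<^esub> g"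
    using g(1) by (metis P.inv_solve_right' P.m_closed P.inv_solve_right)
  then have "proj_class (Q ** std_elem p b 1) = proj_class (std_elem p c m ** Q)"
    using Q by (simp add: proj_class_mult)
  then obtain r where r: "r \<noteq> 0" "Q ** std_elem p b 1 = mat r ** (std_elem p c m ** Q)"
    unfolding proj_class_eq_iff by blast
  have entry: "Q $ i $ j * orbit_vec p b 1 $ j = r * (orbit_vec p c m $ i * Q $ i $ j)" for i j
    using arg_cong[OF r(2), of "\<lambda>M. M $ i $ j"]
    unfolding std_elem_def mat_mult_left diag_matrix_mult_left diag_matrix_mult_right by simp
  have "\<exists>i. orbit_vec p b 1 $ j = r * orbit_vec p c m $ i" for j
  proof -
    obtain R where "R ** Q = mat 1" using Q(1) invertible_left_inverse by blast
    then have "(R ** Q) $ j $ j = 1" by (simp add: mat_def)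
    then have "(\<Sum>i\<in>UNIV. R $ j $ i * Q $ i $ j) = 1" by (simp add: matrix_matrix_mult_def)
    then have "\<exists>i. Q $ i $ j \<noteq> 0" by (rule contrapos_pp) simp
    then obtain i where "Q $ i $ j \<noteq> 0" by blast
    then have "orbit_vec p b 1 $ j = r * orbit_vec p c m $ i" using entry[of i j] by simp
    then show ?thesis by blast
  qed
  then obtain f where f: "\<And>j. orbit_vec p b 1 $ j = r * orbit_vec p c m $ f j" by metis
  define E :: "3 \<Rightarrow> int" where "E i = (if i = 1 then 0 else if i = 2 then m else c * m)" for i
  have E: "orbit_vec p c m $ i = unity_root p (E i)" for i
    using exhaust_3[of i] by (auto simp: orbit_vec_def E_def)
  have f1: "1 = r * unity_root p (E (f 1))" using f[of 1] unfolding E by (simp add: orbit_vec_def)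
  have "unity_root p 1 = r * unity_root p (E (f 2))" "unity_root p b = r * unity_root p (E (f 3))"
    using f[of 2] f[of 3] unfolding E by (simp_all add: orbit_vec_def)
  moreover define q where "q = int p"
  ultimately have "unity_root p 1 = unity_root p (E (f 2) - E (f 1))"
    "unity_root p b = unity_root p (E (f 3) - E (f 1))"
    using f1 by (simp_all add: unity_root_diff field_simps)
  then have *: "q dvd 1 - (E (f 2) - E (f 1))" "q dvd b - (E (f 3) - E (f 1))"
    using p0 by (simp_all add: unity_root_eq_iff q_def)
  \<comment> \<open>the matching is injective because \<open>0, 1, b\<close> are distinct modulo \<open>p\<close>\<close>
  have ne: "f 1 \<noteq> f 2" "f 1 \<noteq> f 3" using * p1 b(1) unfolding q_def by auto
  have "f 2 \<noteq> f 3"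
  proof
    assume "f 2 = f 3"
    then have "q dvd b - 1" using dvd_diff[OF *(2,1)] by simp
    then show False using b(2) by (simp add: q_def)
  qed
  with ne exhaust_3[of "f 1"] exhaust_3[of "f 2"] exhaust_3[of "f 3"]
  consider "f 1 = 1" "f 2 = 2" "f 3 = 3" | "f 1 = 1" "f 2 = 3" "f 3 = 2"
    | "f 1 = 2" "f 2 = 1" "f 3 = 3" | "f 1 = 2" "f 2 = 3" "f 3 = 1"
    | "f 1 = 3" "f 2 = 1" "f 3 = 2" | "f 1 = 3" "f 2 = 2" "f 3 = 1"
    by metis
  then show ?thesis
  proof cases
    case 1
    then have "q dvd 1 - m" "q dvd b - c * m" using * by (simp_all add: E_def)
    then have "q dvd c - b"
      by (rule dvd_combination[where s = "c" and t = "-1"]) (simp add: algebra_simps)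
    then show ?thesis unfolding anharmonic_iff_dvd q_def by blast
  next
    case 2
    then have "q dvd 1 - c * m" "q dvd b - m" using * by (simp_all add: E_def)
    then have "q dvd b * c - 1"
      by (rule dvd_combination[where s = "-1" and t = "c"]) (simp add: algebra_simps)
    then show ?thesis unfolding anharmonic_iff_dvd q_def by blast
  next
    case 3
    then have "q dvd 1 + m" "q dvd b - (c * m - m)" using * by (simp_all add: E_def)
    then have "q dvd c - (1 - b)"
      by (rule dvd_combination[where s = "c - 1" and t = "1"]) (simp add: algebra_simps)
    then show ?thesis unfolding anharmonic_iff_dvd q_def by blast
  next
    case 4
    then have "q dvd 1 - (c * m - m)" "q dvd b + m" using * by (simp_all add: E_def)
    then have "q dvd b * (1 - c) - 1"
      by (rule dvd_combination[where s = "-1" and t = "1 - c"]) (simp add: algebra_simps)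
    then show ?thesis unfolding anharmonic_iff_dvd q_def by blast
  next
    case 5
    then have "q dvd 1 + c * m" "q dvd b - (m - c * m)" using * by (simp_all add: E_def)
    then have "q dvd (1 - b) * c - 1"
      by (rule dvd_combination[where s = "c - 1" and t = "-c"]) (simp add: algebra_simps)
    then show ?thesis unfolding anharmonic_iff_dvd q_def by blast
  next
    case 6
    then have "q dvd 1 - (m - c * m)" "q dvd b + c * m" using * by (simp_all add: E_def)
    then have "q dvd (1 - b) * (1 - c) - 1"
      by (rule dvd_combination[where s = "-c" and t = "c - 1"]) (simp add: algebra_simps)
    then show ?thesis unfolding anharmonic_iff_dvd q_def by blast
  qed
qed


section \<open>Normal form of admissible groups and the number of classes\<close>
lemma not_dvd_range:
  fixes p b :: int
  assumes "b \<in> {2..<p}"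
  shows "\<not> p dvd b" "\<not> p dvd b - 1"
  using assms zdvd_not_zless[of b p] zdvd_not_zless[of "b - 1" p] by auto

text \<open>The \<open>p\<close>-th power of any representative is a scalar \<open>c\<close>; dividing the representative by
  a \<open>p\<close>-th root of \<open>c\<close> makes the power the identity.\<close>
lemma torsion_representative:
  fixes f :: "(complex^'n^'n) set" and p :: nat
  assumes f: "f \<in> carrier PGL" and pow: "f [^]\<^bsub>PGL\<^esub> p = \<one>\<^bsub>PGL\<^esub>" and p: "p > 0"
  obtains A where "invertible A" "f = proj_class A" "A [^]\<^bsub>GL\<^esub> p = mat 1"
proof -
  interpret GL: group "GL :: (complex^'n^'n) monoid" by (rule group_GL)
  obtain B where B: "invertible B" "f = proj_class B" using f unfolding carrier_PGL by blast
  have "proj_class (B [^]\<^bsub>GL\<^esub> p) = proj_class (mat 1)"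
    using pow by (simp add: B proj_class_pow one_PGL)
  then obtain c where c: "c \<noteq> 0" "B [^]\<^bsub>GL\<^esub> p = mat c" unfolding proj_class_eq_iff by auto
  have "card {z. z ^ p = c} = p" using c(1) p by (intro card_nth_roots)
  then obtain s where s: "s ^ p = c" using p by (metis (mono_tags, lifting) Collect_empty_eq card.empty less_irrefl)
  then have s0: "s \<noteq> 0" using c(1) p by (auto simp: power_0_left)
  define A where "A = mat (1 / s) ** B"
  have A: "proj_class A = f"
    unfolding B(2) A_def proj_class_eq_iff using s0 by (intro exI[of _ "1 / s"]) simp
  have invA: "invertible A"
  proof -
    obtain C where "C ** B = mat 1" using B(1) invertible_left_inverse by blast
    then have "(C ** mat s) ** A = mat 1"
      unfolding A_def using s0
      by (metis matrix_mul_assoc matrix_mul_rid mat_mult_mat nonzero_mult_div_cancel_left mult.right_neutral times_divide_eq_right)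
    then show ?thesis unfolding invertible_left_inverse by blast
  qed
  have "A [^]\<^bsub>GL\<^esub> n = mat ((1 / s) ^ n) ** B [^]\<^bsub>GL\<^esub> n" for n :: nat
  proof (induction n)
    case (Suc n)
    have "A [^]\<^bsub>GL\<^esub> Suc n = (mat ((1 / s) ^ n) ** B [^]\<^bsub>GL\<^esub> n) ** (mat (1 / s) ** B)"
      using Suc by (simp add: A_def)
    also have "\<dots> = mat ((1 / s) ^ n) ** (B [^]\<^bsub>GL\<^esub> n ** mat (1 / s)) ** B"
      by (simp only: matrix_mul_assoc)
    also have "\<dots> = (mat ((1 / s) ^ n) ** mat (1 / s)) ** (B [^]\<^bsub>GL\<^esub> n ** B)"
      by (simp only: mat_commute[of "B [^]\<^bsub>GL\<^esub> n"] matrix_mul_assoc)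
    also have "\<dots> = mat ((1 / s) ^ Suc n) ** B [^]\<^bsub>GL\<^esub> Suc n"
      by (simp add: mat_mult_mat mult.commute)
    finally show ?case .
  qed simp
  then have "A [^]\<^bsub>GL\<^esub> p = mat 1" using c s s0 by (simp add: mat_mult_mat power_divide)
  then show ?thesis using that[OF invA A[symmetric]] by blast
qed

text \<open>The eigenvalues \<open>\<zeta>\<^sup>k\<^sup>1, \<zeta>\<^sup>k\<^sup>2, \<zeta>\<^sup>k\<^sup>3\<close> of a generator are distinct, and the affine map sending \<open>k1\<close> to \<open>0\<close> and
  \<open>k2\<close> to \<open>1\<close> modulo \<open>p\<close> sends \<open>k3\<close> to the parameter \<open>b\<close>, which is neither \<open>0\<close> nor \<open>1\<close>.\<close>
lemma admissible_imp_std_class: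
  fixes p :: nat and H :: "(complex^3^3) set set"
  assumes p: "prime p" "p > 3"
    and H: "admissible H" "cyclic_group (PGL\<lparr>carrier := H\<rparr>)" "card H = p"
  shows "\<exists>b\<in>{2..<int p}. orbit PGL (conjugate PGL) H = std_class p b"
proof -
  interpret P: group "PGL :: (complex^3^3) set monoid" by (rule group_PGL)
  have p0: "p > 0" "odd p" using p prime_odd_nat by auto
  have pi: "prime (int p)" using p by simp
  have sub: "subgroup H PGL" using H(1) by (simp add: admissible_def)
  then have H_sub: "H \<subseteq> carrier PGL" by (rule subgroup.subset)
  interpret H: group "PGL\<lparr>carrier := H\<rparr>" by (rule subgroup.subgroup_is_group[OF sub group_PGL])
  obtain f where f: "f \<in> H" "H = range (\<lambda>n::int. f [^]\<^bsub>PGL\<^esub> n)"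
    using H(2) unfolding H.cyclic_group by (auto simp: P.int_pow_consistent[OF sub, symmetric])
  have "f [^]\<^bsub>PGL\<^esub> p = \<one>\<^bsub>PGL\<^esub>"
    using comm_group.power_order_eq_one[OF H.cyclic_imp_abelian_group[OF H(2)], of f]
      f(1) H(3) p0(1) P.nat_pow_consistent[of f p H] card_gt_0_iff[of H] by simp
  then obtain A where A: "invertible A" "f = proj_class A" "A [^]\<^bsub>GL\<^esub> p = mat 1"
    using torsion_representative[of f p] f(1) H_sub p0(1) by blast
  have nonscalar: "A \<noteq> mat r" for r
  proof
    assume r: "A = mat r"
    have "r \<noteq> 0"
    proof
      assume "r = 0"
      obtain B where "B ** A = mat 1" using A(1) invertible_left_inverse by blast
      from arg_cong[OF this, of "\<lambda>M. M $ 1 $ 1"] show False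
        unfolding r mat_mult_right by (simp add: \<open>r = 0\<close> mat_def)
    qed
    then have "f = \<one>\<^bsub>PGL\<^esub>"
      unfolding A(2) one_PGL proj_class_eq_iff using r by (intro exI[of _ r]) simp
    then have "H = {\<one>\<^bsub>PGL\<^esub>}" using f(2) by auto
    then show False using H(3) p by simp
  qed
  obtain T where T: "finite T" "card T \<ge> 5" "general_position T" "H \<subseteq> Aut T"
    using H(1) by (auto simp: admissible_def)
  have "(`) ((*v) A) ` T = proj_act f ` T"
  proof (rule image_cong[OF refl])
    fix L assume "L \<in> T"
    then have "L \<in> proj_space" using T(3) by (auto simp: general_position_def)
    from proj_act_coset[OF this, of A] show "(*v) A ` L = proj_act f L"
      unfolding A(2) proj_class_def by simp
  qed
  also have "\<dots> = T" using T(4) f(1) unfolding Aut_def by blast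
  finally have AT: "(`) ((*v) A) ` T = T" .
  obtain Q :: "complex^3^3" and d where Q: "invertible Q" "A ** Q = Q ** diag_matrix d" and d: "\<And>i. d $ i ^ p = 1"
    using diagonalization_of_root[OF A(1,3) p0(1)] by metis
  have inj: "inj_on (($) d) UNIV"
    by (rule distinct_eigenvalues_if_general_position[OF A(1,3) p0(2) Q T(1-3) AT nonscalar])
  have "\<exists>k. d $ i = unity_root p k" for i by (rule unity_root_exists[OF d p0(1)]) blast
  then obtain k where k: "\<And>i. d $ i = unity_root p (k i)" by metis
  have ne: "\<not> int p dvd k i - k j" if "i \<noteq> j" for i j
  proof
    assume "int p dvd k i - k j"
    then have "d $ i = d $ j" unfolding k unity_root_eq_iff[OF p0(1)] .
    then show False using inj_onD[OF inj] that by blast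
  qed
  define i where "i = k 2 - k 1"
  define q where "q = int p"
  define j where "j = k 3 - k 1"
  have "\<not> q dvd i" using ne[of 2 1] by (simp add: i_def q_def)
  then have "coprime i q"
    using prime_imp_coprime[of q i] pi by (simp add: q_def coprime_commute)
  then obtain m where m: "q dvd i * m - 1"
    using cong_solve_coprime_int cong_iff_dvd_diff by blast
  have "\<not> q dvd j * m"
  proof
    assume "q dvd j * m"
    then have "q dvd j" using m
      by (rule dvd_combination[where s = "i" and t = "-j"]) (simp add: algebra_simps)
    then show False using ne[of 3 1] by (simp add: j_def q_def)
  qed
  moreover have "\<not> q dvd j * m - 1"
  proof
    assume "q dvd j * m - 1"
    then have "q dvd j - i" using m
      by (rule dvd_combination[where s = "i" and t = "-j"]) (simp add: algebra_simps)
    then show False using ne[of 3 2] by (simp add: i_def j_def q_def)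
  qed
  ultimately obtain b where b: "b \<in> {2..<q}" "q dvd b - j * m"
    using exists_representative[of q "j * m"] p by (auto simp: q_def)
  have "q dvd b * i - j" using b(2) m
      by (rule dvd_combination[where s = "i" and t = "j"]) (simp add: algebra_simps)
  then have bi: "int p dvd b * i - j" by (simp add: q_def)
  have "\<exists>g\<in>carrier PGL. conjugate PGL g H = std_subgroup p b"
  proof (rule conjugate_to_std[OF p0(1) A(1) Q _ H(3) _ _ _ bi])
    show "H = range (\<lambda>n::int. proj_class A [^]\<^bsub>PGL\<^esub> n)" using f(2) by (simp only: A(2))
  qed (simp_all add: k i_def j_def unity_root_diff)
  then show ?thesis
    using b(1)[unfolded q_def] P.orbit_conjugate_eq_iff[OF H_sub std_subgroup_carrier] by blast
qed

theorem theorem1: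
  fixes p \<Phi> :: nat
  assumes "prime p" and "p > 3" and "\<Phi> = p - 2"
  defines "X \<equiv> {H :: (complex^3^3) set set.
                  admissible H \<and> cyclic_group (PGL\<lparr>carrier := H\<rparr>) \<and> card H = p}"
  shows "(\<not> [p = 1] (mod 3) \<longrightarrow>
            real (card (orbits PGL X (conjugate PGL))) = 1 + (real \<Phi> - 3) / 6) \<and>
         ([p = 1] (mod 3) \<longrightarrow>
            real (card (orbits PGL X (conjugate PGL))) = 2 + (real \<Phi> - 5) / 6)"
proof -
  have "std_subgroup p b \<in> X" if "b \<in> {2..<int p}" for b
    unfolding X_def
    using std_subgroup_admissible[OF assms(1,2) not_dvd_range[OF that]] std_subgroup_cyclic
      std_subgroup_card[of p b] assms(2) by simp
  moreover have "\<exists>b\<in>{2..<int p}. orbit PGL (conjugate PGL) H = std_class p b" if "H \<in> X" for H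
    using admissible_imp_std_class[OF assms(1,2)] that unfolding X_def by blast
  ultimately have orbits: "orbits PGL X (conjugate PGL) = std_class p ` {2..<int p}"
    unfolding orbits_def by blast
  have "std_class p b = std_class p c \<longleftrightarrow> anharmonic (int p) b c" if "b \<in> {2..<int p}" for b c
    using std_class_eq_imp_anharmonic[OF assms(1) not_dvd_range[OF that]]
      anharmonic_imp_std_class_eq[of p b c] assms(2) by auto
  then obtain e m where em: "e \<le> 1" "p - 2 = 3 + 2 * e + 6 * m"
    "card (orbits PGL X (conjugate PGL)) = 1 + e + m"
    using card_anharmonic_classes[OF assms(1,2), of "std_class p"] unfolding orbits by blast
  \<comment> \<open>whether the class of size two exists is decided by \<open>p\<close> modulo \<open>3\<close>\<close>
  have p: "p = 5 + 2 * e + 6 * m" using em(2) by simp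
  from em(1) consider "e = 0" | "e = 1" by linarith
  then show ?thesis
  proof cases
    case 1
    then have "p mod 3 = 2" using p by presburger
    then show ?thesis using 1 em p assms(3) by (simp add: cong_def)
  next
    case 2
    then have "p mod 3 = 1" using p by presburger
    then show ?thesis using 2 em p assms(3) by (simp add: cong_def)
  qed
qed

end
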